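(* Let $G$ be a connected graph of order $n\geq 4$. Then $m(-1)=n-3$ if and only if $G\in\{P_4,\ K_{n-2}\vee 2K_1\}$. In addition, each such $G$ is determined by its $\mathcal{A}$-spectrum.
   Context: $P_4$ is the path on 4 vertices, $K_{n-2}$ the complete graph on $n-2$ vertices, $2K_1$ two isolated vertices, $\vee$ the join. For a connected graph $G$, $d(u,v)$ is the distance and $\varepsilon(v)=\max_u d(u,v)$ the eccentricity. The eccentricity matrix $\mathcal{A}(G)$ is indexed by $V(G)$ with $(u,v)$-entry $d(u,v)$ if $d(u,v)=\min\{\varepsilon(u),\varepsilon(v)\}$ and $0$ otherwise; its $\mathcal{A}$-spectrum is the multiset of its eigenvalues. $m(-1)$ is the multiplicity of $-1$ in the $\mathcal{A}$-spectrum. A graph $G$ is determined by its $\mathcal{A}$-spectrum if every connected graph with the same $\mathcal{A}$-spectrum is isomorphic to $G$. *)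

theory Defs
  imports
    "HOL-Computational_Algebra.Polynomial"
    "Jordan_Normal_Form.Char_Poly"
    "Graph_Theory.Graph_Theory"
begin

text \<open>
  A finite simple graph is a \<^locale>\<open>pair_graph\<close>: every edge is represented by its two
  opposite arcs. Pair graphs are coerced to general digraphs by \<^const>\<open>with_proj\<close>.
  Connectedness is \<^const>\<open>Digraph_Component.connected\<close>, written qualified because
  topological connectedness has the same base name.
\<close>

definition connected_graph :: "'a pair_pre_digraph \<Rightarrow> bool" where
  "connected_graph G \<longleftrightarrow> pair_graph G \<and> Digraph_Component.connected (with_proj G)"

definition graph_iso :: "'a pair_pre_digraph \<Rightarrow> 'b pair_pre_digraph \<Rightarrow> bool" where
  "graph_iso G H \<longleftrightarrow> digraph_iso (with_proj G) (with_proj H)"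

definition path_graph :: "nat \<Rightarrow> nat pair_pre_digraph" where
  "path_graph n = \<lparr> pverts = {..<n},
     parcs = {(i, j). i < n \<and> j < n \<and> (j = i + 1 \<or> i = j + 1)} \<rparr>"

definition complete_graph :: "nat \<Rightarrow> nat pair_pre_digraph" where
  "complete_graph n = \<lparr> pverts = {..<n}, parcs = {(i, j). i < n \<and> j < n \<and> i \<noteq> j} \<rparr>"

text \<open>The graph $m K_1$ of \<open>m\<close> isolated vertices.\<close>

definition isolated_graph :: "nat \<Rightarrow> nat pair_pre_digraph" where
  "isolated_graph m = \<lparr> pverts = {..<m}, parcs = {} \<rparr>"

definition graph_join ::
    "'a pair_pre_digraph \<Rightarrow> 'b pair_pre_digraph \<Rightarrow> ('a + 'b) pair_pre_digraph"
    (infixl "\<or>\<^sub>G" 65) where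
  "G \<or>\<^sub>G H = \<lparr> pverts = pverts G <+> pverts H,
     parcs = map_prod Inl Inl ` parcs G \<union> map_prod Inr Inr ` parcs H
       \<union> (Inl ` pverts G) \<times> (Inr ` pverts H) \<union> (Inr ` pverts H) \<times> (Inl ` pverts G) \<rparr>"

text \<open>
  The distance is the library's shortest-path cost with all arcs of weight 1. It is finite
  between any two vertices of a connected graph.
\<close>

definition gdist :: "'a pair_pre_digraph \<Rightarrow> 'a \<Rightarrow> 'a \<Rightarrow> real" where
  "gdist G u v = real_of_ereal (wf_digraph.\<mu> (with_proj G) (\<lambda>_. 1) u v)"

definition eccentricity :: "'a pair_pre_digraph \<Rightarrow> 'a \<Rightarrow> real" where
  "eccentricity G v = Max (gdist G v ` pverts G)"

definition ecc_entry :: "'a pair_pre_digraph \<Rightarrow> 'a \<Rightarrow> 'a \<Rightarrow> real" where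
  "ecc_entry G u v =
     (if gdist G u v = min (eccentricity G u) (eccentricity G v) then gdist G u v else 0)"

text \<open>
  Library matrices are indexed by natural numbers, so the eccentricity matrix is taken with
  respect to a listing \<open>vs\<close> of the vertices. Different listings give matrices that are
  simultaneous row and column permutations of each other, hence the same spectrum.
\<close>

definition ecc_matrix :: "'a pair_pre_digraph \<Rightarrow> 'a list \<Rightarrow> real mat" where
  "ecc_matrix G vs = mat (length vs) (length vs) (\<lambda>(i, j). ecc_entry G (vs ! i) (vs ! j))"

definition vertex_list :: "'a pair_pre_digraph \<Rightarrow> 'a list" where
  "vertex_list G = (SOME vs. distinct vs \<and> set vs = pverts G)"

definition ecc_spectrum :: "'a pair_pre_digraph \<Rightarrow> complex multiset" where
  "ecc_spectrum G = proots (char_poly (map_mat complex_of_real (ecc_matrix G (vertex_list G))))"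

text \<open>
  The competing graphs \<open>H\<close> have vertices in the type \<open>'b\<close>; a statement that is polymorphic
  in \<open>'b\<close> covers all connected graphs.
\<close>

definition determined_by_ecc_spectrum :: "'b itself \<Rightarrow> 'a pair_pre_digraph \<Rightarrow> bool" where
  "determined_by_ecc_spectrum (_ :: 'b itself) G \<longleftrightarrow>
     (\<forall>H :: 'b pair_pre_digraph.
        connected_graph H \<and> ecc_spectrum H = ecc_spectrum G \<longrightarrow> graph_iso H G)"

end

(*
  Let A be the eccentricity matrix and M = A + I. Since A is real symmetric, the multiplicity of -1
  is n - rank M, so m(-1) = n - 3 forces any four columns of M to be linearly dependent. If the
  diameter D is at least 3, this is applied to the two ends of a diametral geodesic and their
  neighbours on it: the determinant factors so that D = 3 and both neighbours have eccentricity 2.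
  The relation among the four columns then leaves no admissible entries for a fifth vertex, so
  G = P_4. If D = 2, then a third vertex of eccentricity 2 together with any fourth vertex gives four
  independent columns, so exactly one pair of vertices is non-adjacent. A complete graph has rank M = 1.
  Conversely both graphs have rank M = 3, and for n = 4 they are separated by the eigenvalue -2.
*)
theory Submission
  imports
    Defs
    "Jordan_Normal_Form.Schur_Decomposition"
    "HOL-Computational_Algebra.Fundamental_Theorem_Algebra"
begin


text \<open>Multiplicity is read off the characteristic polynomial, whereas the graph argument needs
  linear relations between columns. The bridge is a triangular form of A - aI whose vanishing
  diagonal entries, m of them, come first. Its last n - m rows are independent, so a factorization
  through r terms forces n - m \<le> r. Conversely, more than n - m columns always carry a nonzero
  vector that some power of A - aI annihilates, and symmetry brings the power down to one. All rank
  statements are used in these two forms. Relations are preferred to vanishing 4 by 4 minors because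
  a relation holds in every row, also in that of a vertex outside the chosen four; this is what
  constrains a fifth vertex when the diameter is three.\<close>

section \<open>Eigenvalue multiplicity and linear relations\<close>

text \<open>Gaussian elimination: an unknown \<open>p\<close> occurring in equation \<open>l\<close>
  is solved for and substituted into the others, which leaves one equation and one unknown
  fewer.\<close>

lemma underdetermined_system:
  fixes U :: "'i \<Rightarrow> 'l \<Rightarrow> 'f::field"
  assumes "finite L" "finite S" "card L < card S"
  shows "\<exists>c. (\<exists>i\<in>S. c i \<noteq> 0) \<and> (\<forall>l\<in>L. (\<Sum>i\<in>S. c i * U i l) = 0)"
  using assms
proof (induction L arbitrary: S U rule: finite_induct)
  case empty
  then have "S \<noteq> {}" by auto
  then show ?case by (intro exI[of _ "\<lambda>_. 1"]) auto
next
  case (insert l L)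
  show ?case
  proof (cases "\<forall>i\<in>S. U i l = 0")
    case True
    have "card L < card S" using insert by simp
    with insert.IH[OF insert.prems(1)] obtain c where
      "\<exists>i\<in>S. c i \<noteq> 0" "\<forall>m\<in>L. (\<Sum>i\<in>S. c i * U i m) = 0" by blast
    with True show ?thesis by (intro exI[of _ c]) auto
  next
    case False
    then obtain p where p: "p \<in> S" "U p l \<noteq> 0" by auto
    have "card L < card (S - {p})" using insert p by simp
    with insert.IH[of "S - {p}" "\<lambda>i m. U i m - U i l / U p l * U p m"] insert.prems obtain c where
      c: "\<exists>i\<in>S-{p}. c i \<noteq> 0"
         "\<forall>m\<in>L. (\<Sum>i\<in>S-{p}. c i * (U i m - U i l / U p l * U p m)) = 0" by auto
    \<comment> \<open>The value of the unknown \<open>p\<close> dictated by equation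
      \<open>l\<close>.\<close>
    define b where "b = - (\<Sum>i\<in>S-{p}. c i * U i l) / U p l"
    have sum_eq: "(\<Sum>i\<in>S. (c(p := b)) i * U i m) = b * U p m + (\<Sum>i\<in>S-{p}. c i * U i m)" for m
      using p insert.prems(1) by (subst sum.remove[of _ p]) (auto intro!: sum.cong)
    have "(\<Sum>i\<in>S. (c(p := b)) i * U i m) = 0" if "m \<in> insert l L" for m
    proof (cases "m = l")
      case True
      then show ?thesis unfolding sum_eq using p by (simp add: b_def)
    next
      case False
      with that c(2) have "(\<Sum>i\<in>S-{p}. c i * (U i m - U i l / U p l * U p m)) = 0" by auto
      then show ?thesis unfolding sum_eq unfolding b_def
        by (simp add: right_diff_distrib sum_subtractf sum_distrib_right sum_divide_distrib mult.assoc)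
    qed
    moreover have "\<exists>i\<in>S. (c(p := b)) i \<noteq> 0" using c(1) by auto
    ultimately show ?thesis by blast
  qed
qed

text \<open>Schur decomposition realises any prescribed order of the roots on the diagonal, so all
  copies of \<open>a\<close> can be listed first.\<close>

lemma schur_with_eigenvalue_first:
  fixes A :: "complex mat" and a :: complex
  assumes A: "A \<in> carrier_mat n n"
  defines "m \<equiv> count (proots (char_poly A)) a"
  obtains B P Q where "similar_mat_wit A B P Q" "upper_triangular B" "m \<le> n"
    "\<And>i. i < m \<Longrightarrow> B $$ (i, i) = a" "\<And>i. m \<le> i \<Longrightarrow> i < n \<Longrightarrow> B $$ (i, i) \<noteq> a"
proof -
  let ?p = "char_poly A"
  obtain es where es: "mset es = filter_mset (\<lambda>x. x \<noteq> a) (proots ?p)" by (metis ex_mset)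
  define fs where "fs = replicate m a @ es"
  have roots: "mset fs = proots ?p"
    by (rule multiset_eqI) (auto simp: fs_def es m_def)
  have "lead_coeff ?p = 1" using degree_monic_char_poly[OF A] by simp
  then have "?p = (\<Prod>x\<in>#proots ?p. [:-x, 1:])"
    using complex_poly_decompose_multiset[of ?p] by simp
  also have "\<dots> = (\<Prod>x\<leftarrow>fs. [:-x, 1:])"
    unfolding roots[symmetric] mset_map[symmetric] prod_mset_prod_list ..
  finally have "?p = (\<Prod>x\<leftarrow>fs. [:-x, 1:])" .
  then obtain B P Q where BPQ: "similar_mat_wit A B P Q" "upper_triangular B" "diag_mat B = fs"
    using schur_decomposition[OF A, of fs] by (metis prod_cases3)
  then have B: "B \<in> carrier_mat n n" using similar_mat_witD2[OF A] by blast
  then have len: "length fs = n" using BPQ(3) by (auto simp: diag_mat_def)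
  have d: "B $$ (i, i) = fs ! i" if "i < n" for i
    using BPQ(3) B that by (auto simp: diag_mat_def)
  have mn: "m \<le> n" using len by (auto simp: fs_def)
  show ?thesis
  proof (rule that[OF BPQ(1,2) mn])
    show "B $$ (i, i) = a" if "i < m" for i using that mn d by (simp add: fs_def nth_append)
    show "B $$ (i, i) \<noteq> a" if "m \<le> i" "i < n" for i
    proof -
      have "fs ! i \<in> set es" using that len by (auto simp: fs_def nth_append)
      then show ?thesis using d that es by (metis (mono_tags, lifting) mem_Collect_eq set_mset_filter set_mset_mset)
    qed
  qed
qed

text \<open>Scalar matrices commute with conjugation, so the same \<open>P\<close> and
  \<open>Q\<close> that triangularise \<open>A\<close> also triangularise A - aI.\<close>

lemma char_matrix_schur:
  fixes A :: "complex mat" and a :: complex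
  assumes A: "A \<in> carrier_mat n n"
  defines "m \<equiv> count (proots (char_poly A)) a"
  obtains N P Q where "similar_mat_wit (char_matrix A a) N P Q" "m \<le> n"
    "\<And>i j. i < n \<Longrightarrow> j < i \<Longrightarrow> N $$ (i, j) = 0"
    "\<And>i. i < m \<Longrightarrow> N $$ (i, i) = 0" "\<And>i. m \<le> i \<Longrightarrow> i < n \<Longrightarrow> N $$ (i, i) \<noteq> 0"
proof -
  obtain B P Q where BPQ: "similar_mat_wit A B P Q" "upper_triangular B" "m \<le> n"
    "\<And>i. i < m \<Longrightarrow> B $$ (i, i) = a" "\<And>i. m \<le> i \<Longrightarrow> i < n \<Longrightarrow> B $$ (i, i) \<noteq> a"
    by (rule schur_with_eigenvalue_first[OF A, of a, folded m_def]) (rule that; simp)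
  note D = similar_mat_witD2[OF A BPQ(1)]
  have N: "char_matrix B a = B + (-a) \<cdot>\<^sub>m 1\<^sub>m n" using D(5) by (auto simp: char_matrix_def)
  have "P * char_matrix B a * Q = (P * B + P * ((-a) \<cdot>\<^sub>m 1\<^sub>m n)) * Q"
    unfolding N by (subst mult_add_distrib_mat[of P n n]) (use D in auto)
  also have "\<dots> = P * B * Q + (P * ((-a) \<cdot>\<^sub>m 1\<^sub>m n)) * Q"
    by (subst add_mult_distrib_mat[of _ n n]) (use D in auto)
  also have "(P * ((-a) \<cdot>\<^sub>m 1\<^sub>m n)) * Q = (-a) \<cdot>\<^sub>m (P * Q)"
    using D by (simp add: mult_smult_distrib[of _ n n _ n] mult_smult_assoc_mat[of _ n n _ n])
  also have "P * B * Q + (-a) \<cdot>\<^sub>m (P * Q) = char_matrix A a"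
    using D A by (simp add: char_matrix_def)
  finally have sim: "similar_mat_wit (char_matrix A a) (char_matrix B a) P Q"
    using D A by (intro similar_mat_witI[of _ _ n]) auto
  have entry: "char_matrix B a $$ (i, j) = B $$ (i, j) - (if i = j then a else 0)"
    if "i < n" "j < n" for i j using that D by (simp add: N)
  have lower: "char_matrix B a $$ (i, j) = 0" if "i < n" "j < i" for i j
  proof -
    have "B $$ (i, j) = 0" using that BPQ(2) D by auto
    then show ?thesis using that by (simp add: entry)
  qed
  have zero: "char_matrix B a $$ (i, i) = 0" if "i < m" for i
    using that BPQ(3,4) by (simp add: entry)
  have nonzero: "char_matrix B a $$ (i, i) \<noteq> 0" if "m \<le> i" "i < n" for i
    using that BPQ(5) by (simp add: entry)
  show ?thesis by (rule that[OF sim BPQ(3) lower zero nonzero])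
qed

text \<open>For y = Mx the squared norm of y equals the inner product of x with My, by Hermitian
  symmetry, and My = 0.\<close>

lemma hermitian_kernel_square:
  fixes M :: "complex mat"
  assumes M: "M \<in> carrier_mat n n" and herm: "\<And>i j. i < n \<Longrightarrow> j < n \<Longrightarrow> M $$ (j, i) = cnj (M $$ (i, j))"
    and x: "x \<in> carrier_vec n" and zero: "M *\<^sub>v (M *\<^sub>v x) = 0\<^sub>v n"
  shows "M *\<^sub>v x = 0\<^sub>v n"
proof -
  define y where "y = M *\<^sub>v x"
  have y: "y \<in> carrier_vec n" using M x by (simp add: y_def)
  have yi: "y $ i = (\<Sum>j<n. M $$ (i, j) * x $ j)" if "i < n" for i
    using that M x by (auto simp: y_def scalar_prod_def atLeast0LessThan intro!: sum.cong)
  have My: "(\<Sum>j<n. M $$ (i, j) * y $ j) = 0" if "i < n" for i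
  proof -
    have "(M *\<^sub>v y) $ i = 0" using that zero by (simp add: y_def)
    then show ?thesis using that M y by (auto simp: scalar_prod_def atLeast0LessThan)
  qed
  have cnj_y: "cnj (y $ i) = (\<Sum>j<n. cnj (x $ j) * M $$ (j, i))" if "i < n" for i
    using that by (simp add: yi herm[symmetric] mult.commute)
  have "(\<Sum>i<n. cnj (y $ i) * y $ i) = (\<Sum>i<n. \<Sum>j<n. cnj (x $ j) * (M $$ (j, i) * y $ i))"
    by (intro sum.cong refl) (simp add: cnj_y sum_distrib_right mult.assoc)
  also have "\<dots> = (\<Sum>j<n. cnj (x $ j) * (\<Sum>i<n. M $$ (j, i) * y $ i))"
    by (subst sum.swap) (simp add: sum_distrib_left)
  also have "\<dots> = 0" by (simp add: My)
  finally have "complex_of_real (\<Sum>i<n. (cmod (y $ i))\<^sup>2) = 0"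
    by (simp add: complex_norm_square mult.commute del: of_real_power)
  then have "(\<Sum>i<n. (cmod (y $ i))\<^sup>2) = 0" using of_real_eq_0_iff by blast
  then have "\<forall>i<n. y $ i = 0" by (simp add: sum_nonneg_eq_0_iff)
  then show ?thesis using y by (auto simp: y_def[symmetric])
qed

text \<open>Algebraic multiplicity first yields only a generalised eigenvector supported on
  \<open>S\<close>. The Hermitian hypothesis turns it into a genuine kernel vector, whose entries
  are the coefficients of the relation.\<close>

lemma dependent_columns_char_matrix:
  fixes A :: "complex mat" and a :: complex
  assumes A: "A \<in> carrier_mat n n"
    and herm: "\<And>i j. i < n \<Longrightarrow> j < n \<Longrightarrow> char_matrix A a $$ (j, i) = cnj (char_matrix A a $$ (i, j))"
    and S: "S \<subseteq> {..<n}" and large: "n < count (proots (char_poly A)) a + card S"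
  shows "\<exists>c. (\<exists>j\<in>S. c j \<noteq> 0) \<and> (\<forall>i<n. (\<Sum>j\<in>S. c j * char_matrix A a $$ (i, j)) = 0)"
proof -
  define m where "m = count (proots (char_poly A)) a"
  let ?M = "char_matrix A a"
  obtain N P Q where NPQ: "similar_mat_wit ?M N P Q" "m \<le> n"
    "\<And>i j. i < n \<Longrightarrow> j < i \<Longrightarrow> N $$ (i, j) = 0" "\<And>i. i < m \<Longrightarrow> N $$ (i, i) = 0"
    "\<And>i. m \<le> i \<Longrightarrow> i < n \<Longrightarrow> N $$ (i, i) \<noteq> 0"
    by (rule char_matrix_schur[OF A, of a, folded m_def]) (rule that; simp)
  have M: "?M \<in> carrier_mat n n" using A by simp
  note D = similar_mat_witD2[OF M NPQ(1)]
  have fin: "finite S" using S finite_subset by blast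
  \<comment> \<open>The n - m equations state that coordinates \<open>m\<close> and beyond of
    \<open>Q w\<close> vanish; the unknowns are the entries of w on \<open>S\<close>.\<close>
  have "card {m..<n} < card S" using large NPQ(2) by (simp add: m_def)
  then obtain c where c: "\<exists>i\<in>S. c i \<noteq> 0" "\<forall>l\<in>{m..<n}. (\<Sum>i\<in>S. c i * Q $$ (l, i)) = 0"
    using underdetermined_system[of "{m..<n}" S "\<lambda>i l. Q $$ (l, i)"] fin by auto
  define w where "w = vec n (\<lambda>i. if i \<in> S then c i else 0)"
  have w: "w \<in> carrier_vec n" by (simp add: w_def)
  have mult_w: "(X *\<^sub>v w) $ i = (\<Sum>j\<in>S. c j * X $$ (i, j))" if "X \<in> carrier_mat n n" "i < n" for X i
  proof -
    have "(X *\<^sub>v w) $ i = (\<Sum>j<n. if j \<in> S then c j * X $$ (i, j) else 0)"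
      using that by (auto simp: scalar_prod_def atLeast0LessThan w_def intro!: sum.cong)
    also have "\<dots> = (\<Sum>j\<in>S. c j * X $$ (i, j))"
      using S by (subst sum.inter_restrict[symmetric]) (auto simp: Int_absorb1)
    finally show ?thesis .
  qed
  let ?Mk = "\<lambda>k. ((\<lambda>v. ?M *\<^sub>v v) ^^ k)" and ?Nk = "\<lambda>k. ((\<lambda>v. N *\<^sub>v v) ^^ k)"
  have Nk: "?Nk k (Q *\<^sub>v w) \<in> carrier_vec n" for k
    by (induction k) (use D w in auto)
  have Mk: "?Mk k w \<in> carrier_vec n" for k
    by (induction k) (use w mult_mat_vec_carrier[OF M] in auto)
  have MN: "?Mk k w = P *\<^sub>v ?Nk k (Q *\<^sub>v w)" for k
  proof (induction k)
    case 0
    then show ?case using D w by (simp add: assoc_mult_mat_vec[of P n n Q n, symmetric])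
  next
    case (Suc k)
    let ?x = "?Nk k (Q *\<^sub>v w)"
    have x: "?x \<in> carrier_vec n" by (rule Nk)
    have "?Mk (Suc k) w = (P * N * Q) *\<^sub>v (P *\<^sub>v ?x)" using Suc D(3) by simp
    also have "\<dots> = P *\<^sub>v (N *\<^sub>v (Q *\<^sub>v (P *\<^sub>v ?x)))"
      using D x by (simp add: assoc_mult_mat_vec[of _ n n _ n])
    also have "Q *\<^sub>v (P *\<^sub>v ?x) = ?x"
      using D x by (simp add: assoc_mult_mat_vec[of Q n n P n, symmetric])
    finally show ?case by simp
  qed
  \<comment> \<open>On vectors supported on the first \<open>m\<close> coordinates \<open>N\<close> is strictly triangular, hence nilpotent.\<close>
  have supp: "\<forall>i<n. m \<le> i + k \<longrightarrow> ?Nk k (Q *\<^sub>v w) $ i = 0" for k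
  proof (induction k)
    case 0
    then show ?case using c(2) by (simp add: mult_w[OF D(7)] del: index_mult_mat_vec)
  next
    case (Suc k)
    show ?case
    proof (intro allI impI)
      fix i assume i: "i < n" "m \<le> i + Suc k"
      let ?x = "?Nk k (Q *\<^sub>v w)"
      have "(N *\<^sub>v ?x) $ i = (\<Sum>j<n. N $$ (i, j) * ?x $ j)"
        using i D Nk[of k] by (auto simp: scalar_prod_def atLeast0LessThan)
      also have "\<dots> = 0"
      proof (rule sum.neutral, safe)
        fix j assume j: "j < n"
        show "N $$ (i, j) * ?x $ j = 0"
        proof (cases "m \<le> j + k")
          case True
          then show ?thesis using Suc j by simp
        next
          case False
          then have "j < i \<or> (j = i \<and> i < m)" using i by linarith
          then show ?thesis using NPQ i by auto
        qed
      qed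
      finally show "?Nk (Suc k) (Q *\<^sub>v w) $ i = 0" by simp
    qed
  qed
  \<comment> \<open>By \<open>supp\<close>, already \<open>m\<close> applications annihilate the
    vector; the exponent is taken as a successor because the descent below starts from one.\<close>
  have "?Nk (Suc n) (Q *\<^sub>v w) = 0\<^sub>v n"
    using supp[of "Suc n"] NPQ(2) D(5) by (intro eq_vecI) auto
  moreover have "P *\<^sub>v 0\<^sub>v n = 0\<^sub>v n" using D(6) by (intro eq_vecI) (auto simp: scalar_prod_def)
  ultimately have Mn: "?Mk (Suc n) w = 0\<^sub>v n" using MN[of "Suc n"] by simp
  \<comment> \<open>Each use of \<open>hermitian_kernel_square\<close> removes one factor of the
    power.\<close>
  have "?Mk (Suc k) w = 0\<^sub>v n \<Longrightarrow> ?M *\<^sub>v w = 0\<^sub>v n" for k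
  proof (induction k)
    case (Suc k)
    have "?Mk (Suc k) w = 0\<^sub>v n"
      using hermitian_kernel_square[OF M herm Mk[of k]] Suc.prems by simp
    then show ?case by (rule Suc.IH)
  qed simp
  from this[OF Mn] have "?M *\<^sub>v w = 0\<^sub>v n" .
  then have "\<forall>i<n. (\<Sum>j\<in>S. c j * ?M $$ (i, j)) = 0" using mult_w[OF M] by (metis index_zero_vec(1))
  then show ?thesis using c(1) by blast
qed

text \<open>If n - m exceeded \<open>card L\<close>, the last n - m rows of QU would satisfy a
  nontrivial relation. It would pass to QM = QUW and to N = QMP, whose last rows are triangular with
  nonzero diagonal.\<close>

lemma multiplicity_ge_of_factorization:
  fixes A :: "complex mat" and a :: complex
  assumes A: "A \<in> carrier_mat n n" and L: "finite L"
    and fac: "\<And>i j. i < n \<Longrightarrow> j < n \<Longrightarrow> char_matrix A a $$ (i, j) = (\<Sum>l\<in>L. U i l * W l j)"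
  shows "n \<le> count (proots (char_poly A)) a + card L"
proof (rule ccontr)
  assume less: "\<not> ?thesis"
  define m where "m = count (proots (char_poly A)) a"
  let ?M = "char_matrix A a"
  obtain N P Q where NPQ: "similar_mat_wit ?M N P Q" "m \<le> n"
    "\<And>i j. i < n \<Longrightarrow> j < i \<Longrightarrow> N $$ (i, j) = 0" "\<And>i. i < m \<Longrightarrow> N $$ (i, i) = 0"
    "\<And>i. m \<le> i \<Longrightarrow> i < n \<Longrightarrow> N $$ (i, i) \<noteq> 0"
    by (rule char_matrix_schur[OF A, of a, folded m_def]) (rule that; simp)
  have M: "?M \<in> carrier_mat n n" using A by simp
  have D: "Q * P = 1\<^sub>m n" "N = Q * ?M * P" "N \<in> carrier_mat n n" "P \<in> carrier_mat n n" "Q \<in> carrier_mat n n"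
    using similar_mat_witD2[OF M NPQ(1)] similar_mat_wit_sym[OF NPQ(1)]
    by (auto dest: similar_mat_witD2)
  define V where "V i l = (\<Sum>k<n. Q $$ (i, k) * U k l)" for i l
  have "card L < card {m..<n}" using less by (simp add: m_def)
  then obtain c where c: "\<exists>i\<in>{m..<n}. c i \<noteq> 0"
    "\<forall>l\<in>L. (\<Sum>i\<in>{m..<n}. c i * V i l) = 0"
    using underdetermined_system[of L "{m..<n}" V] L by auto
  have QM: "(Q * ?M) $$ (i, j) = (\<Sum>l\<in>L. V i l * W l j)" if "i < n" "j < n" for i j
  proof -
    have "(Q * ?M) $$ (i, j) = (\<Sum>k<n. Q $$ (i, k) * ?M $$ (k, j))"
      using that M D by (auto simp: scalar_prod_def atLeast0LessThan intro!: sum.cong)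
    also have "\<dots> = (\<Sum>k<n. \<Sum>l\<in>L. Q $$ (i, k) * U k l * W l j)"
      using that by (intro sum.cong refl) (simp add: fac sum_distrib_left mult.assoc)
    also have "\<dots> = (\<Sum>l\<in>L. V i l * W l j)"
      by (subst sum.swap) (simp add: V_def sum_distrib_right)
    finally show ?thesis .
  qed
  have cQM: "(\<Sum>i\<in>{m..<n}. c i * (Q * ?M) $$ (i, j)) = 0" if "j < n" for j
  proof -
    have "(\<Sum>i\<in>{m..<n}. c i * (Q * ?M) $$ (i, j)) =
        (\<Sum>i\<in>{m..<n}. \<Sum>l\<in>L. c i * V i l * W l j)"
      using that by (intro sum.cong refl) (simp add: QM sum_distrib_left mult.assoc)
    also have "\<dots> = (\<Sum>l\<in>L. (\<Sum>i\<in>{m..<n}. c i * V i l) * W l j)"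
      by (subst sum.swap) (simp add: sum_distrib_right)
    also have "\<dots> = 0" using c(2) by simp
    finally show ?thesis .
  qed
  have cN: "(\<Sum>i\<in>{m..<n}. c i * N $$ (i, j)) = 0" if "j < n" for j
  proof -
    have "(\<Sum>i\<in>{m..<n}. c i * N $$ (i, j)) = (\<Sum>i\<in>{m..<n}. \<Sum>k<n. c i * (Q * ?M) $$ (i, k) * P $$ (k, j))"
    proof (intro sum.cong refl)
      fix i assume "i \<in> {m..<n}"
      then have "N $$ (i, j) = (\<Sum>k<n. (Q * ?M) $$ (i, k) * P $$ (k, j))"
        using that M D(3-) by (subst D(2), subst index_mult_mat(1))
          (auto simp: scalar_prod_def atLeast0LessThan)
      then show "c i * N $$ (i, j) = (\<Sum>k<n. c i * (Q * ?M) $$ (i, k) * P $$ (k, j))"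
        by (simp add: sum_distrib_left mult.assoc)
    qed
    also have "\<dots> = (\<Sum>k<n. (\<Sum>i\<in>{m..<n}. c i * (Q * ?M) $$ (i, k)) * P $$ (k, j))"
      by (subst sum.swap) (simp add: sum_distrib_right)
    also have "\<dots> = 0" using cQM by simp
    finally show ?thesis .
  qed
  \<comment> \<open>In column \<open>i0\<close>, rows above have coefficient zero by minimality and
    rows below have entry zero by triangularity, so a single nonzero term survives.\<close>
  define i0 where "i0 = (LEAST i. i \<in> {m..<n} \<and> c i \<noteq> 0)"
  have i0: "i0 \<in> {m..<n}" "c i0 \<noteq> 0"
    using c(1) LeastI_ex[of "\<lambda>i. i \<in> {m..<n} \<and> c i \<noteq> 0"] unfolding i0_def by blast+
  have small: "c i = 0" if "i \<in> {m..<n}" "i < i0" for i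
    using not_less_Least[of i "\<lambda>i. i \<in> {m..<n} \<and> c i \<noteq> 0"] that unfolding i0_def by blast
  have "(\<Sum>i\<in>{m..<n}. c i * N $$ (i, i0)) = (\<Sum>i\<in>{m..<n}. if i = i0 then c i0 * N $$ (i0, i0) else 0)"
    by (intro sum.cong refl) (use small NPQ(3) in \<open>auto simp: neq_iff\<close>)
  also have "\<dots> = c i0 * N $$ (i0, i0)" using i0 by simp
  finally show False using cN[of i0] i0 NPQ(5) by auto
qed


section \<open>Graph distance as an integral metric\<close>

text \<open>Isolates what the combinatorial argument needs, free of walks and extended reals.
  \<open>hop_step\<close>, the predecessor of \<open>v\<close> on a geodesic, is what distinguishes
  a graph distance from an arbitrary integral metric.\<close>

locale hop_metric =
  fixes V :: "'a set" and h :: "'a \<Rightarrow> 'a \<Rightarrow> nat"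
  assumes finite_V: "finite V"
    and hop_eq_0_iff: "u \<in> V \<Longrightarrow> v \<in> V \<Longrightarrow> h u v = 0 \<longleftrightarrow> u = v"
    and hop_sym: "u \<in> V \<Longrightarrow> v \<in> V \<Longrightarrow> h u v = h v u"
    and hop_triangle: "u \<in> V \<Longrightarrow> v \<in> V \<Longrightarrow> w \<in> V \<Longrightarrow> h u w \<le> h u v + h v w"
    and hop_step: "u \<in> V \<Longrightarrow> v \<in> V \<Longrightarrow> h u v = Suc k \<Longrightarrow> \<exists>w\<in>V. h u w = k \<and> h w v = 1"
begin

definition ecc :: "'a \<Rightarrow> nat" where
  "ecc v = Max (h v ` V)"

definition entry :: "'a \<Rightarrow> 'a \<Rightarrow> real" where
  "entry u v = (if h u v = min (ecc u) (ecc v) then real (h u v) else 0)"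

lemma hop_self [simp]: "u \<in> V \<Longrightarrow> h u u = 0"
  by (simp add: hop_eq_0_iff)

lemma hop_le_ecc: "v \<in> V \<Longrightarrow> h u v \<le> ecc u"
  unfolding ecc_def using finite_V by simp

lemma ex_hop_eq_ecc:
  assumes "u \<in> V"
  obtains v where "v \<in> V" "h u v = ecc u"
proof -
  have "ecc u \<in> h u ` V" unfolding ecc_def using finite_V assms by (intro Max_in) auto
  then show ?thesis using that by auto
qed

lemma entry_sym: "u \<in> V \<Longrightarrow> v \<in> V \<Longrightarrow> entry u v = entry v u"
  by (simp add: entry_def hop_sym min.commute)

end

text \<open>Between vertices of a connected graph \<open>gdist\<close> is the length of a walk, so
  the rounding is exact there.\<close>

definition hop :: "'a pair_pre_digraph \<Rightarrow> 'a \<Rightarrow> 'a \<Rightarrow> nat" where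
  "hop G u v = nat \<lfloor>gdist G u v\<rfloor>"

context pair_graph
begin

lemma awalk_cost_unit: "awalk_cost (\<lambda>_. 1) p = real (length p)"
  by (simp add: awalk_cost_def sum_list_triv)

text \<open>Symmetry of the arcs makes connectedness strong, so the minimal cost is attained by a
  walk; with unit weights its cost is its length.\<close>

lemma ex_shortest_awalk:
  assumes "connected_graph G" "u \<in> pverts G" "v \<in> pverts G"
  obtains p where "awalk u p v" "length p = hop G u v" "gdist G u v = real (hop G u v)"
    "\<And>q. awalk u q v \<Longrightarrow> hop G u v \<le> length q"
proof -
  have "strongly_connected (with_proj G)"
    using assms(1) symmetric_connected_imp_strongly_connected pair_sym_arcs
    by (auto simp: connected_graph_def)
  then have "u \<rightarrow>\<^sup>*\<^bsub>with_proj G\<^esub> v" using assms by auto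
  then obtain p where p: "apath u p v" "\<mu> (\<lambda>_. 1) u v = awalk_cost (\<lambda>_. 1) p"
    using min_cost_awalk[of u v "\<lambda>_. 1"] by auto
  then have g: "gdist G u v = real (length p)" by (simp add: gdist_def awalk_cost_unit)
  then have len: "length p = hop G u v" by (simp add: hop_def)
  have "hop G u v \<le> length q" if "awalk u q v" for q
    using min_cost_le_walk_cost[OF that, of "\<lambda>_. 1"] p(2) by (simp add: awalk_cost_unit len)
  then show ?thesis using that p(1) g len by (auto simp: apath_def)
qed

text \<open>Every axiom is minimality tested against a reversed, concatenated or truncated shortest
  walk.\<close>

lemma hop_metric_hop:
  assumes "connected_graph G"
  shows "hop_metric (pverts G) (hop G)"
proof
  show "finite (pverts G)" by (rule pair_finite_verts)
next
  fix u v assume uv: "u \<in> pverts G" "v \<in> pverts G"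
  obtain p where p: "awalk u p v" "length p = hop G u v" "\<And>q. awalk u q v \<Longrightarrow> hop G u v \<le> length q"
    using ex_shortest_awalk[OF assms uv] by metis
  show "hop G u v = 0 \<longleftrightarrow> u = v"
    using p uv p(3)[of "[]"] by (auto simp: awalk_Nil_iff)
  obtain q where q: "awalk v q u" "length q = hop G v u" "\<And>q. awalk v q u \<Longrightarrow> hop G v u \<le> length q"
    using ex_shortest_awalk[OF assms uv(2,1)] by metis
  have "length (rev_path r) = length r" for r :: "('a \<times> 'a) list" by (induction r) auto
  then show "hop G u v = hop G v u"
    using p q p(3)[of "rev_path q"] q(3)[of "rev_path p"] by (simp add: antisym)
  fix k assume k: "hop G u v = Suc k"
  \<comment> \<open>The tail of the last arc is the required predecessor: a shorter way to it, or
    from it to \<open>v\<close>, would shorten \<open>p\<close>.\<close>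
  with p obtain p' e where pe: "p = p' @ [e]" by (cases p rule: rev_cases) auto
  then have w: "awalk u p' (fst e)" "e \<in> parcs G" "snd e = v" "length p' = k"
    using p k by (auto simp: awalk_simps)
  let ?w = "fst e"
  have wV: "?w \<in> pverts G" using w by auto
  obtain r where r: "awalk u r ?w" "length r = hop G u ?w" "\<And>q. awalk u q ?w \<Longrightarrow> hop G u ?w \<le> length q"
    using ex_shortest_awalk[OF assms uv(1) wV] by metis
  obtain s where s: "awalk ?w s v" "length s = hop G ?w v" "\<And>q. awalk ?w q v \<Longrightarrow> hop G ?w v \<le> length q"
    using ex_shortest_awalk[OF assms wV uv(2)] by metis
  have e: "awalk ?w [e] v" using w wV uv by (auto simp: awalk_simps)
  have "hop G u ?w \<le> k" using r(3) w by blast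
  moreover have "Suc k \<le> hop G u ?w + 1" using p(3)[of "r @ [e]"] r e k by (auto simp: awalk_appendI)
  moreover have "hop G ?w v \<le> 1" using s(3)[OF e] by simp
  moreover have "Suc k \<le> k + hop G ?w v" using p(3)[of "p' @ s"] w s k by (auto simp: awalk_appendI)
  ultimately show "\<exists>w\<in>pverts G. hop G u w = k \<and> hop G w v = 1" using wV by (intro bexI[of _ ?w]) auto
next
  fix u v w assume V: "u \<in> pverts G" "v \<in> pverts G" "w \<in> pverts G"
  obtain p where p: "awalk u p v" "length p = hop G u v"
    using ex_shortest_awalk[OF assms V(1,2)] by metis
  obtain q where q: "awalk v q w" "length q = hop G v w"
    using ex_shortest_awalk[OF assms V(2,3)] by metis
  obtain r where "\<And>q. awalk u q w \<Longrightarrow> hop G u w \<le> length q"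
    using ex_shortest_awalk[OF assms V(1,3)] by metis
  from this[of "p @ q"] show "hop G u w \<le> hop G u v + hop G v w" using p q by (auto simp: awalk_appendI)
qed

lemma hop_eq_1_iff:
  assumes "connected_graph G" "u \<in> pverts G" "v \<in> pverts G"
  shows "hop G u v = 1 \<longleftrightarrow> (u, v) \<in> parcs G"
proof -
  interpret H: hop_metric "pverts G" "hop G" by (rule hop_metric_hop[OF assms(1)])
  obtain p where p: "awalk u p v" "length p = hop G u v" "\<And>q. awalk u q v \<Longrightarrow> hop G u v \<le> length q"
    using ex_shortest_awalk[OF assms] by metis
  show ?thesis
  proof
    assume "hop G u v = 1"
    with p obtain e where "p = [e]" by (auto simp: length_Suc_conv)
    with p show "(u, v) \<in> parcs G" by (auto simp: awalk_simps)
  next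
    assume e: "(u, v) \<in> parcs G"
    then have "awalk u [(u, v)] v" using assms by (auto simp: awalk_simps)
    then have "hop G u v \<le> 1" using p(3)[of "[(u, v)]"] by simp
    moreover have "hop G u v \<noteq> 0" using e no_loops' assms by (auto simp: H.hop_eq_0_iff)
    ultimately show "hop G u v = 1" by simp
  qed
qed

lemma ecc_entry_eq_entry:
  assumes "connected_graph G" "u \<in> pverts G" "v \<in> pverts G"
  shows "ecc_entry G u v = hop_metric.entry (pverts G) (hop G) u v"
proof -
  interpret H: hop_metric "pverts G" "hop G" by (rule hop_metric_hop[OF assms(1)])
  have g: "gdist G x y = real (hop G x y)" if "x \<in> pverts G" "y \<in> pverts G" for x y
    using ex_shortest_awalk[OF assms(1) that] by metis
  have "eccentricity G x = real (H.ecc x)" if "x \<in> pverts G" for x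
  proof -
    have "eccentricity G x = Max (real ` (hop G x ` pverts G))"
      using that by (auto simp: eccentricity_def g image_image intro!: arg_cong[of _ _ Max])
    also have "\<dots> = real (H.ecc x)"
      unfolding H.ecc_def using H.finite_V that
      by (subst mono_Max_commute[of real, symmetric]) (auto simp: mono_def)
    finally show ?thesis .
  qed
  then show ?thesis using assms by (simp add: ecc_entry_def H.entry_def g flip: of_nat_min)
qed

end

section \<open>From matrix indices to vertices\<close>

lemma vertex_list_props:
  assumes "finite (pverts G)"
  shows "distinct (vertex_list G)" "set (vertex_list G) = pverts G" "length (vertex_list G) = card (pverts G)"
proof -
  have "\<exists>vs. distinct vs \<and> set vs = pverts G" using finite_distinct_list[OF assms] by blast
  from someI_ex[OF this] show *: "distinct (vertex_list G)" "set (vertex_list G) = pverts G"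
    by (auto simp: vertex_list_def)
  then show "length (vertex_list G) = card (pverts G)" using distinct_card by fastforce
qed

lemma size_ecc_spectrum:
  assumes "finite (pverts G)"
  shows "size (ecc_spectrum G) = card (pverts G)"
proof -
  have "map_mat complex_of_real (ecc_matrix G (vertex_list G)) \<in> carrier_mat (card (pverts G)) (card (pverts G))"
    using vertex_list_props[OF assms] by (auto simp: ecc_matrix_def)
  from degree_monic_char_poly[OF this] show ?thesis by (simp add: ecc_spectrum_def size_proots_complex)
qed

lemma ecc_char_matrix:
  fixes G :: "'a pair_pre_digraph" and a :: real
  defines "n \<equiv> length (vertex_list G)"
  defines "A \<equiv> map_mat complex_of_real (ecc_matrix G (vertex_list G))"
  assumes "finite (pverts G)" "i < n" "j < n"
  shows "char_matrix A a $$ (i, j) =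
    of_real (ecc_entry G (vertex_list G ! i) (vertex_list G ! j)
      - (if vertex_list G ! i = vertex_list G ! j then a else 0))"
  using assms vertex_list_props(1)[of G]
  by (auto simp: char_matrix_def ecc_matrix_def nth_eq_iff_index_eq)

text \<open>Carries the column relation from positions in the listing to vertices, and from complex
  to real coefficients, where the order arguments on entries apply.\<close>

lemma ecc_spectrum_dependent_columns:
  fixes G :: "'a pair_pre_digraph" and a :: real
  assumes fin: "finite (pverts G)"
    and sym: "\<And>u v. u \<in> pverts G \<Longrightarrow> v \<in> pverts G \<Longrightarrow> ecc_entry G u v = ecc_entry G v u"
    and S: "S \<subseteq> pverts G" and large: "card (pverts G) < count (ecc_spectrum G) a + card S"
  shows "\<exists>c :: 'a \<Rightarrow> real. (\<exists>v\<in>S. c v \<noteq> 0) \<and>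
    (\<forall>u\<in>pverts G. (\<Sum>v\<in>S. c v * (ecc_entry G u v - (if u = v then a else 0))) = 0)"
proof -
  define vs where "vs = vertex_list G"
  define n where "n = length vs"
  define A where "A = map_mat complex_of_real (ecc_matrix G vs)"
  define f where "f u v = ecc_entry G u v - (if u = v then a else 0)" for u v
  note vs = vertex_list_props[OF fin, folded vs_def]
  have A: "A \<in> carrier_mat n n" by (auto simp: A_def ecc_matrix_def n_def)
  have ent: "char_matrix A a $$ (i, j) = of_real (f (vs ! i) (vs ! j))" if "i < n" "j < n" for i j
    using ecc_char_matrix[OF fin, of i j a] that unfolding A_def n_def vs_def f_def by blast
  have nth: "vs ! i \<in> pverts G" if "i < n" for i
    using nth_mem[of i vs] vs(2) that unfolding n_def by simp
  define I where "I = {i. i < n \<and> vs ! i \<in> S}"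
  have bij: "bij_betw ((!) vs) I S"
    unfolding bij_betw_def
  proof
    show "inj_on ((!) vs) I" using vs by (auto simp: I_def n_def inj_on_def nth_eq_iff_index_eq)
    show "(!) vs ` I = S" using vs S by (force simp: I_def n_def in_set_conv_nth image_iff)
  qed
  have "\<exists>c. (\<exists>j\<in>I. c j \<noteq> 0) \<and> (\<forall>i<n. (\<Sum>j\<in>I. c j * char_matrix A a $$ (i, j)) = 0)"
  proof (rule dependent_columns_char_matrix[OF A])
    show "char_matrix A a $$ (j, i) = cnj (char_matrix A a $$ (i, j))" if "i < n" "j < n" for i j
      using that nth sym by (auto simp: ent f_def)
    show "I \<subseteq> {..<n}" by (auto simp: I_def)
    show "n < count (proots (char_poly A)) (complex_of_real a) + card I"
      using large bij_betw_same_card[OF bij] vs by (simp add: ecc_spectrum_def A_def vs_def n_def)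
  qed
  then obtain c where c: "\<exists>j\<in>I. c j \<noteq> 0"
    and rel: "\<forall>i<n. (\<Sum>j\<in>I. c j * char_matrix A a $$ (i, j)) = 0" by blast
  have c': "(\<Sum>j\<in>I. c j * complex_of_real (f (vs ! i) (vs ! j))) = 0" if "i < n" for i
  proof -
    have "(\<Sum>j\<in>I. c j * complex_of_real (f (vs ! i) (vs ! j))) = (\<Sum>j\<in>I. c j * char_matrix A a $$ (i, j))"
      by (intro sum.cong refl) (simp add: I_def ent that)
    then show ?thesis using rel that by simp
  qed
  \<comment> \<open>The matrix is real, so the real and imaginary parts of a relation are relations again.\<close>
  have ri: "(\<Sum>j\<in>I. Re (c j) * f (vs ! i) (vs ! j)) = 0" "(\<Sum>j\<in>I. Im (c j) * f (vs ! i) (vs ! j)) = 0"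
    if "i < n" for i
    using arg_cong[OF c'[OF that], of Re] arg_cong[OF c'[OF that], of Im] by simp_all
  obtain b where b: "\<exists>j\<in>I. b j \<noteq> (0::real)" "\<And>i. i < n \<Longrightarrow> (\<Sum>j\<in>I. b j * f (vs ! i) (vs ! j)) = 0"
  proof (cases "\<exists>j\<in>I. Re (c j) \<noteq> 0")
    case True
    then show ?thesis using that[of "\<lambda>j. Re (c j)"] ri by blast
  next
    case False
    then have "\<exists>j\<in>I. Im (c j) \<noteq> 0" using c by (auto simp: complex_eq_iff)
    then show ?thesis using that[of "\<lambda>j. Im (c j)"] ri by blast
  qed
  let ?g = "inv_into I ((!) vs)"
  have inv: "?g (vs ! j) = j" if "j \<in> I" for j using bij that by (simp add: bij_betw_def)
  have "(\<Sum>v\<in>S. b (?g v) * f u v) = 0" if u: "u \<in> pverts G" for u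
  proof -
    obtain i where i: "i < n" "u = vs ! i" using u vs(2) in_set_conv_nth[of u vs] unfolding n_def by auto
    have "(\<Sum>v\<in>S. b (?g v) * f u v) = (\<Sum>j\<in>I. b (?g (vs ! j)) * f u (vs ! j))"
      by (rule sum.reindex_bij_betw[OF bij, symmetric])
    also have "\<dots> = 0" using b(2)[OF i(1)] by (simp add: inv i(2))
    finally show ?thesis .
  qed
  moreover have "\<exists>v\<in>S. b (?g v) \<noteq> 0"
  proof -
    obtain j where "j \<in> I" "b j \<noteq> 0" using b(1) by blast
    then show ?thesis using inv bij_betwE[OF bij] by (intro bexI[of _ "vs ! j"]) auto
  qed
  ultimately show ?thesis unfolding f_def by (intro exI[of _ "\<lambda>v. b (?g v)"]) blast
qed

text \<open>\<open>card L\<close> bounds the rank of the shifted matrix. It is 3 for the two graphs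
  of the theorem at -1, 1 for complete graphs, and n - 1 where merely the presence of an eigenvalue
  is wanted.\<close>

lemma ecc_spectrum_count_ge:
  fixes G :: "'a pair_pre_digraph" and a :: real
  assumes fin: "finite (pverts G)" and L: "finite L"
    and fac: "\<And>u v. u \<in> pverts G \<Longrightarrow> v \<in> pverts G \<Longrightarrow>
      ecc_entry G u v - (if u = v then a else 0) = (\<Sum>l\<in>L. U u l * W l v)"
  shows "card (pverts G) \<le> count (ecc_spectrum G) a + card L"
proof -
  define vs where "vs = vertex_list G"
  define n where "n = length vs"
  define A where "A = map_mat complex_of_real (ecc_matrix G vs)"
  note vs = vertex_list_props[OF fin, folded vs_def]
  have A: "A \<in> carrier_mat n n" by (auto simp: A_def ecc_matrix_def n_def)
  have nth: "vs ! i \<in> pverts G" if "i < n" for i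
    using nth_mem[of i vs] vs(2) that unfolding n_def by simp
  have "char_matrix A a $$ (i, j) = (\<Sum>l\<in>L. of_real (U (vs ! i) l) * of_real (W l (vs ! j)))"
    if "i < n" "j < n" for i j
  proof -
    have "char_matrix A a $$ (i, j) = of_real (ecc_entry G (vs ! i) (vs ! j) - (if vs ! i = vs ! j then a else 0))"
      using ecc_char_matrix[OF fin, of i j a] that unfolding A_def n_def vs_def by blast
    then show ?thesis unfolding fac[OF nth[OF that(1)] nth[OF that(2)]] by simp
  qed
  from multiplicity_ge_of_factorization[OF A L this] show ?thesis
    using vs by (simp add: ecc_spectrum_def A_def vs_def n_def)
qed


section \<open>Consequences of four dependent columns\<close>

context hop_metric
begin

text \<open>The matrix A + I, written with a subtracted -1 to agree with the spectral lemmas at a =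
  -1.\<close>

definition shifted :: "'a \<Rightarrow> 'a \<Rightarrow> real" where
  "shifted u v = entry u v - (if u = v then -1 else 0)"

lemma shifted_sym: "u \<in> V \<Longrightarrow> v \<in> V \<Longrightarrow> shifted u v = shifted v u"
  by (simp add: shifted_def entry_sym)

lemma shifted_self: "u \<in> V \<Longrightarrow> shifted u u = 1"
  by (simp add: shifted_def entry_def)

text \<open>Rank at most 3 for A + I, phrased through relations valid in all rows.\<close>

definition four_columns_dependent :: bool where
  "four_columns_dependent \<longleftrightarrow> (\<forall>S\<subseteq>V. card S = 4 \<longrightarrow>
    (\<exists>c :: 'a \<Rightarrow> real. (\<exists>v\<in>S. c v \<noteq> 0) \<and> (\<forall>u\<in>V. (\<Sum>v\<in>S. c v * shifted u v) = 0)))"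

lemma four_columns_dependentE:
  assumes "four_columns_dependent" "{p, q, r, s} \<subseteq> V" "distinct [p, q, r, s]"
  obtains a b c d :: real where "a \<noteq> 0 \<or> b \<noteq> 0 \<or> c \<noteq> 0 \<or> d \<noteq> 0"
    "\<And>u. u \<in> V \<Longrightarrow> a * shifted u p + b * shifted u q + c * shifted u r + d * shifted u s = 0"
proof -
  have "card {p, q, r, s} = 4" using assms(3) by simp
  then obtain c where c: "\<exists>v\<in>{p, q, r, s}. c v \<noteq> 0"
    "\<forall>u\<in>V. (\<Sum>v\<in>{p, q, r, s}. c v * shifted u v) = 0"
    using assms(1,2) unfolding four_columns_dependent_def by blast
  then show ?thesis using assms(3) by (intro that[of "c p" "c q" "c r" "c s"]) (auto simp: add_ac)
qed

text \<open>The rows of the inner vertices express \<open>b\<close> and \<open>c\<close> through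
  \<open>d\<close> and \<open>a\<close>. What remains is a 2 by 2 system with determinant (1 -
  p^2)(1 - q^2) - D^2.\<close>

lemma diameter_ge_3_imp_path:
  assumes dep: four_columns_dependent
    and v: "v0 \<in> V" "v3 \<in> V" and D: "h v0 v3 = D" "D \<ge> 3"
    and max: "\<And>x y. x \<in> V \<Longrightarrow> y \<in> V \<Longrightarrow> h x y \<le> D"
  shows "\<exists>v1 v2. V = {v0, v1, v2, v3} \<and> distinct [v0, v1, v2, v3] \<and>
    h v0 v1 = 1 \<and> h v1 v2 = 1 \<and> h v2 v3 = 1 \<and> h v0 v2 = 2 \<and> h v1 v3 = 2 \<and> h v0 v3 = 3"
proof -
  \<comment> \<open>\<open>hop_step\<close> yields a neighbour of its second argument, so the
    neighbour of \<open>v0\<close> is found on a geodesic starting at \<open>v3\<close>.\<close>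
  have "h v3 v0 = Suc (D - 1)" using D v hop_sym by auto
  then obtain v1 where v1: "v1 \<in> V" "h v3 v1 = D - 1" "h v1 v0 = 1" using hop_step v by blast
  have "h v1 v3 = Suc (D - 2)" using v1 v D hop_sym[of v1 v3] by simp
  then obtain v2 where v2: "v2 \<in> V" "h v1 v2 = D - 2" "h v2 v3 = 1" using hop_step v v1 by blast
  note V = v v1(1) v2(1)
  have h02: "h v0 v2 = D - 1"
    using hop_triangle[of v0 v1 v2] hop_triangle[of v0 v2 v3] hop_sym[of v0 v1] V v1 v2 D by simp
  have h: "h v0 v1 = 1" "h v1 v3 = D - 1" using hop_sym[of v0 v1] hop_sym[of v1 v3] V v1 by auto
  have dist: "distinct [v0, v1, v2, v3]"
    using V D h h02 v2 by (auto simp: hop_eq_0_iff[symmetric] simp del: hop_self)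
  have ecc_le: "ecc x \<le> D" if "x \<in> V" for x
    using ex_hop_eq_ecc[OF that] max that by metis
  have ecc: "ecc v0 = D" "ecc v3 = D" "D - 1 \<le> ecc v1" "D - 1 \<le> ecc v2"
    using ecc_le[of v0] ecc_le[of v3] hop_le_ecc[of v3 v0] hop_le_ecc[of v0 v3] hop_le_ecc[of v3 v1]
      hop_le_ecc[of v0 v2] hop_sym[of v0 v3] hop_sym[of v0 v2] V D h h02 by auto
  have ecc_le': "ecc v1 \<le> D" "ecc v2 \<le> D" using ecc_le V by auto
  have s03: "shifted v0 v3 = D" using dist ecc D by (simp add: shifted_def entry_def)
  have s01: "shifted v0 v1 = 0" using dist ecc ecc_le' D h by (simp add: shifted_def entry_def)
  have s23: "shifted v2 v3 = 0" using dist ecc ecc_le' D v2 by (simp add: shifted_def entry_def)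
  have s12: "shifted v1 v2 = 0" using dist ecc ecc_le' D v2 by (simp add: shifted_def entry_def)
  have s02: "shifted v0 v2 = (if ecc v2 = D - 1 then real D - 1 else 0)"
    using dist ecc ecc_le' D h02 by (simp add: shifted_def entry_def)
  have s13: "shifted v1 v3 = (if ecc v1 = D - 1 then real D - 1 else 0)"
    using dist ecc ecc_le' D h by (simp add: shifted_def entry_def)
  \<comment> \<open>The only entries left open: the inner vertices have eccentricity D - 1 or D, so
    each of \<open>p\<close> and \<open>q\<close> is D - 1 or 0. Distances 1 and D - 2 lie below
    every eccentricity involved and give entry 0.\<close>
  define p q where "p = shifted v0 v2" and "q = shifted v1 v3"
  note sy = shifted_sym[of v1 v0] shifted_sym[of v2 v0] shifted_sym[of v3 v0] shifted_sym[of v2 v1]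
    shifted_sym[of v3 v1] shifted_sym[of v3 v2]
  obtain a b c d :: real where nz: "a \<noteq> 0 \<or> b \<noteq> 0 \<or> c \<noteq> 0 \<or> d \<noteq> 0"
    and rel: "\<And>u. u \<in> V \<Longrightarrow> a * shifted u v0 + b * shifted u v1 + c * shifted u v2 + d * shifted u v3 = 0"
    by (rule four_columns_dependentE[OF dep _ dist]) (use V in auto)
  have e0: "a + c * p + d * D = 0" using rel[of v0] V by (simp add: shifted_self s03 s01 p_def)
  have e1: "b = - d * q" using rel[of v1] V by (simp add: shifted_self sy s01 s12 q_def)
  have e2: "c = - a * p" using rel[of v2] V by (simp add: shifted_self sy s12 s23 p_def)
  have e3: "a * D + b * q + d = 0" using rel[of v3] V by (simp add: shifted_self sy s03 s23 q_def)
  have f0: "a * (1 - p\<^sup>2) + d * D = 0" using e0 e2 by (simp add: algebra_simps power2_eq_square)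
  have f3: "a * D + d * (1 - q\<^sup>2) = 0" using e3 e1 by (simp add: algebra_simps power2_eq_square)
  have ad: "a \<noteq> 0 \<or> d \<noteq> 0" using nz e1 e2 by auto
  have D2: "(real D)\<^sup>2 > 1" using D by (intro one_less_power) auto
  have p0: "p \<noteq> 0"
  proof
    assume "p = 0"
    then have "a = - d * D" using f0 by simp
    then have "d * (1 - q\<^sup>2 - (real D)\<^sup>2) = 0" using f3 by (simp add: algebra_simps power2_eq_square)
    moreover have "1 - q\<^sup>2 - (real D)\<^sup>2 < 0" using D2 zero_le_power2[of q] by linarith
    ultimately show False using ad \<open>a = - d * D\<close> by auto
  qed
  have q0: "q \<noteq> 0"
  proof
    assume "q = 0"
    then have "d = - a * D" using f3 by simp
    then have "a * (1 - p\<^sup>2 - (real D)\<^sup>2) = 0" using f0 by (simp add: algebra_simps power2_eq_square)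
    moreover have "1 - p\<^sup>2 - (real D)\<^sup>2 < 0" using D2 zero_le_power2[of p] by linarith
    ultimately show False using ad \<open>d = - a * D\<close> by auto
  qed
  have pq: "p = real D - 1" "q = real D - 1" "ecc v1 = D - 1" "ecc v2 = D - 1"
    using p0 q0 s02 s13 unfolding p_def q_def by (auto split: if_splits)
  have "q = p" using pq by simp
  \<comment> \<open>For p = q the system is symmetric under exchanging \<open>a\<close> and
    \<open>d\<close>, so it splits along a - d and a + d with factors 1 - p^2 - D and 1 - p^2 + D.
    The former is negative; the latter equals D(3 - D) at p = D - 1.\<close>
  then have "(a - d) * (1 - p\<^sup>2 - D) = 0" using f0 f3 by (simp add: algebra_simps)
  moreover have "1 - p\<^sup>2 - D < 0" using D zero_le_power2[of p] by linarith
  ultimately have ad_eq: "a = d" by auto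
  with f0 ad have "1 - p\<^sup>2 + D = 0" by (simp flip: distrib_left)
  then have "real D * (3 - real D) = 0" unfolding pq by (simp add: algebra_simps power2_eq_square)
  then have D3: "D = 3" using D by auto
  have rel2: "a \<noteq> 0" "b = - 2 * a" "c = - 2 * a" "d = a" using ad ad_eq e1 e2 pq D3 by auto
  have "x \<in> {v0, v1, v2, v3}" if x: "x \<in> V" for x
  proof (rule ccontr)
    assume nx: "x \<notin> {v0, v1, v2, v3}"
    define s0 s1 s2 s3 where "s0 = shifted x v0" and "s1 = shifted x v1" and "s2 = shifted x v2" and "s3 = shifted x v3"
    have ex: "2 \<le> ecc x"
    proof (rule ccontr)
      assume "\<not> ?thesis"
      then have "h x v0 \<le> 1" "h x v3 \<le> 1" using hop_le_ecc[of v0 x] hop_le_ecc[of v3 x] V by auto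
      then show False using hop_triangle[of v0 x v3] hop_sym[of v0 x] V x D D3 by simp
    qed
    have "a * s0 - 2 * a * s1 - 2 * a * s2 + a * s3 = 0"
      using rel[OF x] rel2 by (simp add: s0_def s1_def s2_def s3_def)
    then have "a * (s0 - 2 * s1 - 2 * s2 + s3) = 0" by (simp add: algebra_simps)
    then have main: "s0 + s3 = 2 * s1 + 2 * s2" using rel2(1) by simp
    \<comment> \<open>The inner vertices have eccentricity 2, the ends have 3, and \<open>x\<close>
      has 2 or 3. Entries with inner vertices are therefore 0 or 2, and entries with ends are 0 or
      the eccentricity of \<open>x\<close>.\<close>
    have val: "shifted x y \<in> {0, 2, 3}" if "y \<in> {v0, v1, v2, v3}" for y
      using that nx x V ex ecc pq D3 hop_le_ecc[of y x] ecc_le[OF x] max[of x y] D(2)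
      by (auto simp: shifted_def entry_def min_def)
    have val1: "shifted x y \<in> {0, 2}" if "y \<in> {v1, v2}" for y
      using that nx x V ex ecc pq D3 hop_le_ecc[of y x] ecc_le[OF x] max[of x y] D(2)
      by (auto simp: shifted_def entry_def min_def)
    have s1: "s1 = 0 \<or> s1 = 2" and s2: "s2 = 0 \<or> s2 = 2" and s0: "s0 = 0 \<or> s0 = 2 \<or> s0 = 3"
      and s3: "s3 = 0 \<or> s3 = 2 \<or> s3 = 3"
      using val1[of v1] val1[of v2] val[of v0] val[of v3] by (auto simp: s0_def s1_def s2_def s3_def)
    \<comment> \<open>\<open>main\<close> leaves three cases: all four entries vanish, or
      \<open>s0\<close> and \<open>s3\<close> are 2 and exactly one of \<open>s1\<close>,
      \<open>s2\<close> is 2. In each, the principal 4 by 4 system on these vertices is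
      nonsingular.\<close>
    have dist': "distinct [x, v2, v0, v3]" using dist nx by auto
    obtain a b c d :: real where nz: "a \<noteq> 0 \<or> b \<noteq> 0 \<or> c \<noteq> 0 \<or> d \<noteq> 0"
      and rel: "\<And>u. u \<in> V \<Longrightarrow> a * shifted u x + b * shifted u v2 + c * shifted u v0 + d * shifted u v3 = 0"
      by (rule four_columns_dependentE[OF dep _ dist']) (use V x in auto)
    note sx = shifted_sym[of v0 x] shifted_sym[of v2 x] shifted_sym[of v3 x]
    have "a + b * s2 + c * s0 + d * s3 = 0" "a * s2 + b + c * 2 = 0"
      "a * s0 + b * 2 + c + d * 3 = 0" "a * s3 + c * 3 + d = 0"
      using rel[of x] rel[of v2] rel[of v0] rel[of v3] V x D3 pq
      by (simp_all add: shifted_self sx sy s0_def s2_def s3_def s23 s03 flip: p_def)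
    then show False using nz main s0 s1 s2 s3 by (elim disjE) auto
  qed
  then have "V = {v0, v1, v2, v3}" using V by auto
  then show ?thesis using dist h h02 v2 D(1) unfolding D3 by (intro exI[of _ v1] exI[of _ v2]) simp
qed

text \<open>Both ends of a non-edge have eccentricity 2 here. Once \<open>u\<close> and
  \<open>v\<close> are known to be the only such vertices, every other pair is adjacent.\<close>

lemma diameter_2_imp_one_non_edge:
  assumes dep: four_columns_dependent and card: "card V \<ge> 4"
    and uv: "u \<in> V" "v \<in> V" "h u v = 2"
    and max: "\<And>x y. x \<in> V \<Longrightarrow> y \<in> V \<Longrightarrow> h x y \<le> 2"
    and xy: "x \<in> V" "y \<in> V" "x \<noteq> y" "{x, y} \<noteq> {u, v}"
  shows "h x y = 1"
proof -
  have ecc_le: "ecc x \<le> 2" if "x \<in> V" for x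
    using ex_hop_eq_ecc[OF that] max that by metis
  have pos: "0 < h x y" if "x \<in> V" "y \<in> V" "x \<noteq> y" for x y
    using that hop_eq_0_iff by blast
  have euv: "ecc u = 2" "ecc v = 2" "u \<noteq> v"
    using ecc_le[of u] ecc_le[of v] hop_le_ecc[of v u] hop_le_ecc[of u v] hop_sym[of u v] uv by auto
  have s2: "shifted x y = 0 \<or> shifted x y = 2"
    if "x \<in> V" "y \<in> V" "x \<noteq> y" "ecc x = 2" "ecc y = 2" for x y
    using that max[of x y] by (auto simp: shifted_def entry_def)
  have s1: "shifted x y = 1" if "x \<in> V" "y \<in> V" "x \<noteq> y" "ecc x = 1" for x y
    using that pos[of x y] pos[of y x] hop_le_ecc[of y x] hop_le_ecc[of x y] hop_sym[of x y]
    by (auto simp: shifted_def entry_def min_def)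
  have suv: "shifted u v = 2" using euv uv by (simp add: shifted_def entry_def)
  have no_third: "ecc w \<noteq> 2" if w: "w \<in> V" "w \<noteq> u" "w \<noteq> v" for w
  proof
    assume ew: "ecc w = 2"
    have "card {u, v, w} < card V" using card card_insert_le_m1[of 3 "{v, w}" u]
      by (auto simp: card_insert_if)
    then obtain x where x: "x \<in> V" "x \<noteq> u" "x \<noteq> v" "x \<noteq> w"
      by (metis card_mono finite.emptyI finite_insert insertCI not_less subsetI)
    have dist: "distinct [u, v, w, x]" using w x euv by auto
    obtain a b c d :: real where nz: "a \<noteq> 0 \<or> b \<noteq> 0 \<or> c \<noteq> 0 \<or> d \<noteq> 0"
      and rel: "\<And>t. t \<in> V \<Longrightarrow> a * shifted t u + b * shifted t v + c * shifted t w + d * shifted t x = 0"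
      by (rule four_columns_dependentE[OF dep _ dist]) (use uv w x in auto)
    note V = uv(1,2) w(1) x(1)
    note sy = shifted_sym[of v u] shifted_sym[of w u] shifted_sym[of x u] shifted_sym[of w v]
      shifted_sym[of x v] shifted_sym[of x w]
    define k1 k2 k3 k4 k5 where "k1 = shifted u w" "k2 = shifted v w" "k3 = shifted u x" "k4 = shifted v x" "k5 = shifted w x"
    note k = this
    have eqs: "a + b * 2 + c * k1 + d * k3 = 0" "a * 2 + b + c * k2 + d * k4 = 0"
      "a * k1 + b * k2 + c + d * k5 = 0" "a * k3 + b * k4 + c * k5 + d = 0"
      using rel[of u] rel[of v] rel[of w] rel[of x] V
      by (simp_all add: shifted_self sy suv k)
    have k12: "k1 = 0 \<or> k1 = 2" "k2 = 0 \<or> k2 = 2" using s2[of u w] s2[of v w] V w euv ew by (auto simp: k)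
    consider "ecc x = 1" | "ecc x = 2"
    proof -
      have "0 < ecc x" using pos[of x u] hop_le_ecc[of u x] V x by fastforce
      then show ?thesis using ecc_le[of x] x that by force
    qed
    then show False
    proof cases
      case 1
      \<comment> \<open>Subtracting the row of \<open>x\<close> from the others leaves a symmetric 3
        by 3 block with zero diagonal and off-diagonal entries 1, k1 - 1, k2 - 1. Its determinant is
        2(k1 - 1)(k2 - 1), that is 2 or -2.\<close>
      then have "k3 = 1" "k4 = 1" "k5 = 1" using s1[of x] V x shifted_sym[of _ x] by (auto simp: k)
      with k12 show False using eqs nz by (elim disjE) auto
    next
      case 2
      \<comment> \<open>All off-diagonal entries are even, so modulo 2 the system is the identity
        and its determinant is odd.\<close>
      then have "k3 = 0 \<or> k3 = 2" "k4 = 0 \<or> k4 = 2" "k5 = 0 \<or> k5 = 2"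
        using s2[of u x] s2[of v x] s2[of w x] V x euv ew by (auto simp: k)
      with k12 show False using eqs nz by (elim disjE) auto
    qed
  qed
  have one: "h x y = 1" if "x \<in> V" "y \<in> V" "x \<noteq> y" "x \<noteq> u" "x \<noteq> v" for x y
    using no_third[of x] that ecc_le[of x] pos[of x y] hop_le_ecc[of y x] by force
  show ?thesis
  proof (cases "x \<in> {u, v}")
    case True
    then have "y \<notin> {u, v}" using xy by auto
    then show ?thesis using one[of y x] hop_sym xy by auto
  next
    case False
    then show ?thesis using one xy by auto
  qed
qed

end


section \<open>Isomorphism with the two model graphs\<close>

text \<open>A digraph isomorphism has separate vertex and arc maps. Here arcs are pairs with tail
  \<open>fst\<close> and head \<open>snd\<close> on both sides, which forces the arc map to be
  \<open>map_prod f f\<close>.\<close>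

lemma graph_isoE:
  assumes "graph_iso G H"
  obtains f where "bij_betw f (pverts G) (pverts H)" "pair_wf_digraph G"
    "\<And>u v. u \<in> pverts G \<Longrightarrow> v \<in> pverts G \<Longrightarrow> (u, v) \<in> parcs G \<longleftrightarrow> (f u, f v) \<in> parcs H"
proof -
  obtain m where m: "pre_digraph.digraph_isomorphism (with_proj G) m"
    and H: "with_proj H = app_iso m (with_proj G)"
    using assms by (auto simp: graph_iso_def digraph_iso_def)
  define f where "f = iso_verts m"
  note hom = m[unfolded pre_digraph.digraph_isomorphism_def]
  have wf: "pair_wf_digraph G" using hom wf_digraph_wp_iff by blast
  have "iso_tail m = fst" "iso_head m = snd"
    using arg_cong[OF H, of tail] arg_cong[OF H, of head] by simp_all
  then have "iso_arcs m a = (f (fst a), f (snd a))" if "a \<in> parcs G" for a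
    using hom that by (auto simp: f_def prod_eq_iff)
  then have "iso_arcs m ` parcs G = map_prod f f ` parcs G"
    by (intro image_cong) auto
  then have arcs: "parcs H = map_prod f f ` parcs G" using arg_cong[OF H, of arcs] by simp
  have verts: "pverts H = f ` pverts G" using arg_cong[OF H, of verts] by (simp add: f_def)
  have inj: "inj_on f (pverts G)" using hom by (simp add: f_def)
  have "(u, v) \<in> parcs G \<longleftrightarrow> (f u, f v) \<in> parcs H" if "u \<in> pverts G" "v \<in> pverts G" for u v
  proof
    assume "(f u, f v) \<in> parcs H"
    then obtain x y where xy: "(x, y) \<in> parcs G" "f x = f u" "f y = f v" by (auto simp: arcs)
    then have "x \<in> pverts G" "y \<in> pverts G" using pair_wf_digraph.wellformed'[OF wf] by auto
    then show "(u, v) \<in> parcs G" using xy inj that by (auto simp: inj_on_def)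
  qed (auto simp: arcs)
  then show ?thesis using that inj verts wf by (auto simp: bij_betw_def)
qed

lemma graph_isoI:
  assumes wf: "pair_wf_digraph G" "pair_wf_digraph H" and bij: "bij_betw f (pverts G) (pverts H)"
    and adj: "\<And>u v. u \<in> pverts G \<Longrightarrow> v \<in> pverts G \<Longrightarrow> (u, v) \<in> parcs G \<longleftrightarrow> (f u, f v) \<in> parcs H"
  shows "graph_iso G H"
proof -
  define m where "m = \<lparr>iso_verts = f, iso_arcs = map_prod f f, iso_head = snd, iso_tail = fst\<rparr>"
  have inj: "inj_on f (pverts G)" and img: "f ` pverts G = pverts H" using bij by (auto simp: bij_betw_def)
  note wfG = pair_wf_digraph.wellformed'[OF wf(1)] and wfH = pair_wf_digraph.wellformed'[OF wf(2)]
  have "inj_on (map_prod f f) (parcs G)"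
  proof (rule inj_onI, clarify)
    fix a b c d assume *: "(a, b) \<in> parcs G" "(c, d) \<in> parcs G" "map_prod f f (a, b) = map_prod f f (c, d)"
    then show "a = c \<and> b = d" using inj wfG[OF *(1)] wfG[OF *(2)] by (auto simp: inj_on_def)
  qed
  then have "pre_digraph.digraph_isomorphism (with_proj G) m"
    using wf(1) inj by (simp add: pre_digraph.digraph_isomorphism_def m_def wf_digraph_wp_iff)
  moreover have "parcs H = map_prod f f ` parcs G"
  proof (intro equalityI subsetI)
    fix e assume e: "e \<in> parcs H"
    obtain x y where xy: "e = (x, y)" by fastforce
    then have "x \<in> f ` pverts G" "y \<in> f ` pverts G" using e wfH[of x y] unfolding img by auto
    then obtain u v where "u \<in> pverts G" "v \<in> pverts G" "x = f u" "y = f v" by blast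
    then show "e \<in> map_prod f f ` parcs G" using e xy adj by (intro image_eqI[of _ _ "(u, v)"]) auto
  next
    fix e assume "e \<in> map_prod f f ` parcs G"
    then obtain u v where "(u, v) \<in> parcs G" "e = (f u, f v)" by auto
    then show "e \<in> parcs H" using adj wfG by blast
  qed
  then have "with_proj H = app_iso m (with_proj G)"
    using img by (simp add: with_proj_def app_iso_def m_def)
  ultimately show ?thesis by (auto simp: graph_iso_def digraph_iso_def)
qed

lemma graph_iso_if_common_iso:
  assumes "graph_iso G K" "graph_iso H K"
  shows "graph_iso H G"
proof -
  obtain f where f: "bij_betw f (pverts G) (pverts K)" "pair_wf_digraph G"
    "\<And>u v. u \<in> pverts G \<Longrightarrow> v \<in> pverts G \<Longrightarrow> (u, v) \<in> parcs G \<longleftrightarrow> (f u, f v) \<in> parcs K"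
    by (rule graph_isoE[OF assms(1)]) (rule that)
  obtain g where g: "bij_betw g (pverts H) (pverts K)" "pair_wf_digraph H"
    "\<And>u v. u \<in> pverts H \<Longrightarrow> v \<in> pverts H \<Longrightarrow> (u, v) \<in> parcs H \<longleftrightarrow> (g u, g v) \<in> parcs K"
    by (rule graph_isoE[OF assms(2)]) (rule that)
  define k where "k = inv_into (pverts G) f \<circ> g"
  have k: "k u \<in> pverts G" "f (k u) = g u" if "u \<in> pverts H" for u
    using that f(1) g(1) bij_betw_apply[OF g(1) that]
    by (auto simp: k_def bij_betw_def f_inv_into_f intro: inv_into_into)
  show ?thesis
  proof (rule graph_isoI[OF g(2) f(2), of k])
    show "bij_betw k (pverts H) (pverts G)"
      unfolding k_def by (rule bij_betw_trans[OF g(1) bij_betw_inv_into[OF f(1)]])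
    show "(u, v) \<in> parcs H \<longleftrightarrow> (k u, k v) \<in> parcs G" if "u \<in> pverts H" "v \<in> pverts H" for u v
      using f(3)[of "k u" "k v"] g(3)[OF that] k that by simp
  qed
qed

lemma pair_wf_path_graph: "pair_wf_digraph (path_graph n)"
  by standard (auto simp: path_graph_def)

text \<open>The labelled form serves both directions: distances are computed from it, and the case
  of diameter three produces it.\<close>

lemma graph_iso_path4_iff:
  assumes wf: "pair_wf_digraph G"
  shows "graph_iso G (path_graph 4) \<longleftrightarrow> (\<exists>v0 v1 v2 v3. distinct [v0, v1, v2, v3] \<and>
    pverts G = {v0, v1, v2, v3} \<and>
    parcs G = {(v0, v1), (v1, v0), (v1, v2), (v2, v1), (v2, v3), (v3, v2)})"
    (is "?iso \<longleftrightarrow> ?path")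
proof
  have verts4: "{..<4} = {0, 1, 2, 3::nat}" by auto
  assume ?iso
  then obtain f where f: "bij_betw f (pverts G) {0, 1, 2, 3}"
    "\<And>u v. u \<in> pverts G \<Longrightarrow> v \<in> pverts G \<Longrightarrow> (u, v) \<in> parcs G \<longleftrightarrow> (f u, f v) \<in> parcs (path_graph 4)"
    by (rule graph_isoE) (simp add: path_graph_def verts4 that)
  define g where "g = inv_into (pverts G) f"
  have bij: "bij_betw g {0, 1, 2, 3} (pverts G)" using bij_betw_inv_into[OF f(1)] by (simp add: g_def)
  have fg: "f (g i) = i" "g i \<in> pverts G" if "i \<in> {0, 1, 2, 3}" for i
    using that f(1) bij_betw_apply[OF bij that] by (auto simp: g_def bij_betw_inv_into_right)
  have V: "pverts G = {g 0, g 1, g 2, g 3}" using bij by (auto simp: bij_betw_def)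
  have dist: "distinct [g 0, g 1, g 2, g 3]" using bij by (auto simp: bij_betw_def inj_on_def)
  have adj: "(g i, g j) \<in> parcs G \<longleftrightarrow> j = i + 1 \<or> i = j + 1"
    if "i \<in> {0, 1, 2, 3}" "j \<in> {0, 1, 2, 3}" for i j
  proof -
    have "i < 4" "j < 4" using that by auto
    then show ?thesis
      using f(2)[OF fg(2)[OF that(1)] fg(2)[OF that(2)]] fg(1)[OF that(1)] fg(1)[OF that(2)]
      by (simp add: path_graph_def)
  qed
  have "parcs G \<subseteq> pverts G \<times> pverts G" using pair_wf_digraph.wellformed'[OF wf] by auto
  then have "parcs G = {(g 0, g 1), (g 1, g 0), (g 1, g 2), (g 2, g 1), (g 2, g 3), (g 3, g 2)}"
    using adj unfolding V by (intro equalityI subrelI) auto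
  with V dist show ?path by blast
next
  assume ?path
  then obtain v0 v1 v2 v3 where d: "distinct [v0, v1, v2, v3]" and V: "pverts G = {v0, v1, v2, v3}"
    and E: "parcs G = {(v0, v1), (v1, v0), (v1, v2), (v2, v1), (v2, v3), (v3, v2)}" by blast
  define f where "f x = (if x = v0 then 0 else if x = v1 then 1 else if x = v2 then 2 else 3 :: nat)" for x
  show ?iso
  proof (rule graph_isoI[OF wf pair_wf_path_graph, of f])
    show "bij_betw f (pverts G) (pverts (path_graph 4))"
      using d unfolding bij_betw_def by (auto simp: V f_def path_graph_def inj_on_def)
    show "(u, v) \<in> parcs G \<longleftrightarrow> (f u, f v) \<in> parcs (path_graph 4)" if "u \<in> pverts G" "v \<in> pverts G" for u v
      using that d unfolding V E by (auto simp: f_def path_graph_def)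
  qed
qed

lemma parcs_graph_join_iff:
  "(Inl a, Inl b) \<in> parcs (G \<or>\<^sub>G H) \<longleftrightarrow> (a, b) \<in> parcs G"
  "(Inr c, Inr d) \<in> parcs (G \<or>\<^sub>G H) \<longleftrightarrow> (c, d) \<in> parcs H"
  "(Inl a, Inr d) \<in> parcs (G \<or>\<^sub>G H) \<longleftrightarrow> a \<in> pverts G \<and> d \<in> pverts H"
  "(Inr c, Inl b) \<in> parcs (G \<or>\<^sub>G H) \<longleftrightarrow> c \<in> pverts H \<and> b \<in> pverts G"
  by (auto simp: graph_join_def)

text \<open>The join is a complete graph minus the edge between the two isolated vertices.\<close>

lemma arc_complete_join_isolated2_iff:
  "(x, y) \<in> parcs (complete_graph m \<or>\<^sub>G isolated_graph 2) \<longleftrightarrow>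
    x \<in> {..<m} <+> {..<2} \<and> y \<in> {..<m} <+> {..<2} \<and> x \<noteq> y \<and> {x, y} \<noteq> {Inr 0, Inr 1}"
proof (cases x; cases y)
  fix c d assume "x = Inr c" "y = Inr d"
  then show ?thesis
    by (auto simp: parcs_graph_join_iff isolated_graph_def doubleton_eq_iff less_2_cases_iff)
qed (auto simp: parcs_graph_join_iff complete_graph_def isolated_graph_def doubleton_eq_iff)

lemma pverts_complete_join_isolated:
  "pverts (complete_graph m \<or>\<^sub>G isolated_graph k) = {..<m} <+> {..<k}"
  by (simp add: graph_join_def complete_graph_def isolated_graph_def)

text \<open>The ends of the missing edge become the isolated vertices. All others are adjacent to
  everything, so any bijection onto the complete part serves for them.\<close>

lemma graph_iso_complete_join_isolated2_iff:
  assumes wf: "pair_wf_digraph G" and fin: "finite (pverts G)" and n: "card (pverts G) = n" "n \<ge> 2"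
  shows "graph_iso G (complete_graph (n - 2) \<or>\<^sub>G isolated_graph 2) \<longleftrightarrow>
    (\<exists>u v. u \<in> pverts G \<and> v \<in> pverts G \<and> u \<noteq> v \<and>
      (\<forall>x\<in>pverts G. \<forall>y\<in>pverts G. (x, y) \<in> parcs G \<longleftrightarrow> x \<noteq> y \<and> {x, y} \<noteq> {u, v}))"
    (is "graph_iso G ?K \<longleftrightarrow> ?one_non_edge")
proof
  assume "graph_iso G ?K"
  then obtain f where f: "bij_betw f (pverts G) ({..<n - 2} <+> {..<2})"
    "\<And>u v. u \<in> pverts G \<Longrightarrow> v \<in> pverts G \<Longrightarrow> (u, v) \<in> parcs G \<longleftrightarrow> (f u, f v) \<in> parcs ?K"
    by (rule graph_isoE) (simp add: pverts_complete_join_isolated that)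
  have inj: "f x = f y \<longleftrightarrow> x = y" if "x \<in> pverts G" "y \<in> pverts G" for x y
    using f(1) that by (auto simp: bij_betw_def inj_on_def)
  have "Inr 0 \<in> f ` pverts G" "Inr 1 \<in> f ` pverts G" by (auto simp: bij_betw_imp_surj_on[OF f(1)])
  then obtain u v where uv: "u \<in> pverts G" "v \<in> pverts G" "f u = Inr 0" "f v = Inr 1"
    by (elim imageE, intro that) simp_all
  have "(x, y) \<in> parcs G \<longleftrightarrow> x \<noteq> y \<and> {x, y} \<noteq> {u, v}" if xy: "x \<in> pverts G" "y \<in> pverts G" for x y
  proof -
    have "{f x, f y} = {f u, f v} \<longleftrightarrow> {x, y} = {u, v}" using xy uv(1,2) by (simp add: doubleton_eq_iff inj)
    then show ?thesis
      using xy f(2)[OF xy] inj[OF xy] bij_betwE[OF f(1)] uv by (simp add: arc_complete_join_isolated2_iff)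
  qed
  moreover have "u \<noteq> v" using uv by auto
  ultimately show ?one_non_edge using uv by blast
next
  assume ?one_non_edge
  then obtain u v where uv: "u \<in> pverts G" "v \<in> pverts G" "u \<noteq> v"
    and adj: "\<forall>x\<in>pverts G. \<forall>y\<in>pverts G. (x, y) \<in> parcs G \<longleftrightarrow> x \<noteq> y \<and> {x, y} \<noteq> {u, v}"
    by blast
  let ?W = "pverts G - {u, v}"
  have "card ?W = card {..<n - 2}" using uv n fin by (simp add: card_Diff_subset)
  then obtain g where g: "bij_betw g ?W {..<n - 2}" using fin finite_same_card_bij[of ?W "{..<n - 2}"] by auto
  define f where "f x = (if x = u then Inr 0 else if x = v then Inr 1 else Inl (g x) :: nat + nat)" for x
  have bij: "bij_betw f (pverts G) ({..<n - 2} <+> {..<2})"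
    unfolding bij_betw_def
  proof
    have inj_g: "inj_on g ?W" using g by (simp add: bij_betw_def)
    show "inj_on f (pverts G)"
    proof (rule inj_onI)
      fix x y assume "x \<in> pverts G" "y \<in> pverts G" "f x = f y"
      then show "x = y" using inj_onD[OF inj_g, of x y]
        by (cases "x = u"; cases "x = v"; cases "y = u"; cases "y = v") (simp_all add: f_def split: if_splits)
    qed
    have "insert u (insert v ?W) = pverts G" using uv by auto
    then have "f ` pverts G = f ` insert u (insert v ?W)" by (rule arg_cong[OF sym])
    also have "\<dots> = insert (f u) (insert (f v) (f ` ?W))" by simp
    also have "f ` ?W = Inl ` g ` ?W" by (auto simp: f_def image_iff)
    also have "g ` ?W = {..<n - 2}" by (rule bij_betw_imp_surj_on[OF g])
    finally show "f ` pverts G = {..<n - 2} <+> {..<2}"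
      using uv(3) by (auto simp: f_def Plus_def less_2_cases_iff)
  qed
  have inj: "f x = f y \<longleftrightarrow> x = y" if "x \<in> pverts G" "y \<in> pverts G" for x y
    using bij that by (auto simp: bij_betw_def inj_on_def)
  show "graph_iso G ?K"
  proof (rule graph_isoI[OF wf, of _ f])
    show "pair_wf_digraph ?K"
      by standard (auto simp: arc_complete_join_isolated2_iff pverts_complete_join_isolated)
    show "bij_betw f (pverts G) (pverts ?K)" using bij by (simp add: pverts_complete_join_isolated)
    show "(x, y) \<in> parcs G \<longleftrightarrow> (f x, f y) \<in> parcs ?K" if xy: "x \<in> pverts G" "y \<in> pverts G" for x y
    proof -
      have "{f x, f y} = {f u, f v} \<longleftrightarrow> {x, y} = {u, v}"
        using xy uv(1,2) by (simp add: doubleton_eq_iff inj)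
      moreover have "f u = Inr 0" "f v = Inr 1" using uv by (auto simp: f_def)
      ultimately show ?thesis using adj[rule_format, OF xy] inj[OF xy] bij_betwE[OF bij] xy
        by (simp add: arc_complete_join_isolated2_iff)
    qed
  qed
qed


section \<open>Spectra of the two model graphs\<close>

context hop_metric
begin

lemma path4_entry:
  assumes V: "V = {v0, v1, v2, v3}" and d: "distinct [v0, v1, v2, v3]"
    and one: "\<And>x y. x \<in> V \<Longrightarrow> y \<in> V \<Longrightarrow> h x y = 1 \<longleftrightarrow>
      (x, y) \<in> {(v0, v1), (v1, v0), (v1, v2), (v2, v1), (v2, v3), (v3, v2)}"
  shows "entry v0 v1 = 0" "entry v0 v2 = 2" "entry v0 v3 = 3" "entry v1 v2 = 0" "entry v1 v3 = 2" "entry v2 v3 = 0"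
proof -
  note in_V = V[THEN equalityD2, THEN subsetD]
  have h: "h v0 v1 = 1" "h v1 v2 = 1" "h v2 v3 = 1" "h v0 v2 \<noteq> 1" "h v1 v3 \<noteq> 1" "h v0 v3 \<noteq> 1"
    using one d V by auto
  have ne: "h v0 v2 \<noteq> 0" "h v1 v3 \<noteq> 0" "h v0 v3 \<noteq> 0"
    using d V by (simp_all add: hop_eq_0_iff)
  have h2: "h v0 v2 = 2" "h v1 v3 = 2"
    using hop_triangle[of v0 v1 v2] hop_triangle[of v1 v2 v3] h ne V by auto
  \<comment> \<open>Distance 2 would require a common neighbour of the two ends.\<close>
  have "h v0 v3 \<noteq> 2"
  proof
    assume "h v0 v3 = 2"
    then have "h v0 v3 = Suc 1" by simp
    then obtain w where "w \<in> V" "h v0 w = 1" "h w v3 = 1" using hop_step V by blast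
    then show False using one[of v0 w] one[of w v3] d V by auto
  qed
  then have h3: "h v0 v3 = 3"
    using hop_triangle[of v0 v2 v3] h h2 ne V by auto
  have self: "h v0 v0 = 0" "h v1 v1 = 0" "h v2 v2 = 0" "h v3 v3 = 0" using V by auto
  have sy: "h v1 v0 = 1" "h v2 v1 = 1" "h v3 v2 = 1" "h v2 v0 = 2" "h v3 v1 = 2" "h v3 v0 = 3"
    using hop_sym V h h2 h3 by auto
  have "ecc x = Max (h x ` {v0, v1, v2, v3})" for x unfolding ecc_def unfolding V ..
  then have "ecc v0 = 3" "ecc v1 = 2" "ecc v2 = 2" "ecc v3 = 3"
    by (simp_all add: self sy h h2 h3)
  then show "entry v0 v1 = 0" "entry v0 v2 = 2" "entry v0 v3 = 3" "entry v1 v2 = 0" "entry v1 v3 = 2" "entry v2 v3 = 0"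
    by (simp_all add: entry_def h h2 h3)
qed

text \<open>A third vertex is adjacent to both \<open>u\<close> and \<open>v\<close>, so these are
  at distance 2. Every vertex other than \<open>u\<close> and \<open>v\<close> has eccentricity 1,
  and each edge contains such a vertex, hence keeps its entry 1.\<close>

lemma one_non_edge_entry:
  assumes card: "card V \<ge> 3" and uv: "u \<in> V" "v \<in> V" "u \<noteq> v"
    and one: "\<And>x y. x \<in> V \<Longrightarrow> y \<in> V \<Longrightarrow> h x y = 1 \<longleftrightarrow> x \<noteq> y \<and> {x, y} \<noteq> {u, v}"
    and xy: "x \<in> V" "y \<in> V"
  shows "entry x y = (if x = y then 0 else if {x, y} = {u, v} then 2 else 1)"
proof -
  obtain s where s: "s \<in> V" "s \<noteq> u" "s \<noteq> v"
  proof -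
    have "card {u, v} < card V" using card uv by simp
    then have "\<not> V \<subseteq> {u, v}" using card_mono[of "{u, v}" V] by auto
    then show ?thesis using that by auto
  qed
  have one': "h x y = 1" if "x \<in> V" "y \<in> V" "x \<noteq> y" "x \<notin> {u, v} \<or> y \<notin> {u, v}" for x y
    using one[OF that(1,2)] that by (auto simp: doubleton_eq_iff)
  have "h u v \<noteq> 1" "h u v \<noteq> 0" using one[OF uv(1,2)] hop_eq_0_iff[OF uv(1,2)] uv by auto
  moreover have "h u v \<le> h u s + h s v" using hop_triangle uv s by blast
  moreover have "h u s = 1" "h s v = 1" using one' uv s by auto
  ultimately have huv: "h u v = 2" by simp
  have hvu: "h v u = 2" using huv hop_sym uv by simp
  have le2: "h x y \<le> 2" if "x \<in> V" "y \<in> V" for x y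
  proof (cases "x = y \<or> x \<notin> {u, v} \<or> y \<notin> {u, v}")
    case True
    then show ?thesis using one'[of x y] that by (cases "x = y") auto
  next
    case False
    then show ?thesis using huv hvu by auto
  qed
  have ecc_le2: "ecc x \<le> 2" if "x \<in> V" for x using ex_hop_eq_ecc[OF that] le2 that by metis
  have eu: "ecc u = 2" "ecc v = 2"
    using ecc_le2[of u] ecc_le2[of v] hop_le_ecc[of v u] hop_le_ecc[of u v] huv hvu uv by auto
  have ecc1: "ecc x = 1" if x: "x \<in> V" "x \<notin> {u, v}" for x
  proof -
    obtain y where y: "y \<in> V" "h x y = ecc x" using ex_hop_eq_ecc[OF x(1)] by blast
    have "h x u = 1" using one'[of x u] x uv by auto
    then have "1 \<le> ecc x" using hop_le_ecc[of u x] uv by simp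
    moreover have "h x y \<le> 1" using one'[of x y] x y by (cases "x = y") auto
    ultimately show ?thesis using y by simp
  qed
  have pos: "1 \<le> ecc x" if "x \<in> V" for x using ecc1[OF that] eu by (cases "x \<in> {u, v}") auto
  consider "x = y" | "x \<noteq> y" "{x, y} = {u, v}" | "x \<noteq> y" "{x, y} \<noteq> {u, v}" by blast
  then show ?thesis
  proof cases
    case 1
    then show ?thesis using xy by (simp add: entry_def)
  next
    case 2
    then have "x = u \<and> y = v \<or> x = v \<and> y = u" by (simp add: doubleton_eq_iff)
    then show ?thesis using 2 huv hvu eu by (auto simp: entry_def)
  next
    case 3
    then have "x \<notin> {u, v} \<or> y \<notin> {u, v}" by auto
    then have "min (ecc x) (ecc y) = 1" using ecc1[OF xy(1)] ecc1[OF xy(2)] pos[OF xy(1)] pos[OF xy(2)] by auto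
    moreover have "h x y = 1" using one[OF xy] 3 by simp
    ultimately show ?thesis using 3 by (simp add: entry_def)
  qed
qed

end

lemma connected_graph_finite: "connected_graph G \<Longrightarrow> finite (pverts G)"
  using pair_fin_digraph.pair_finite_verts pair_graph.axioms(1) pair_digraph.axioms(1)
  unfolding connected_graph_def by blast

lemma connected_graph_entry_sym:
  assumes "connected_graph G" "u \<in> pverts G" "v \<in> pverts G"
  shows "ecc_entry G u v = ecc_entry G v u"
proof -
  interpret pair_graph G using assms(1) by (simp add: connected_graph_def)
  interpret H: hop_metric "pverts G" "hop G" by (rule hop_metric_hop[OF assms(1)])
  show ?thesis using assms by (simp add: ecc_entry_eq_entry H.entry_sym)
qed

text \<open>The upper bound on the multiplicity, obtained by exhibiting independent columns of the
  shifted matrix.\<close>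

lemma ecc_spectrum_count_le:
  fixes a :: real
  assumes G: "connected_graph G" and S: "S \<subseteq> pverts G"
    and ind: "\<And>c :: 'a \<Rightarrow> real. (\<And>u. u \<in> pverts G \<Longrightarrow>
      (\<Sum>v\<in>S. c v * (ecc_entry G u v - (if u = v then a else 0))) = 0) \<Longrightarrow> \<forall>v\<in>S. c v = 0"
  shows "count (ecc_spectrum G) a + card S \<le> card (pverts G)"
proof (rule ccontr)
  assume "\<not> ?thesis"
  then obtain c :: "'a \<Rightarrow> real" where "\<exists>v\<in>S. c v \<noteq> 0"
    "\<forall>u\<in>pverts G. (\<Sum>v\<in>S. c v * (ecc_entry G u v - (if u = v then a else 0))) = 0"
    using ecc_spectrum_dependent_columns[OF connected_graph_finite[OF G] connected_graph_entry_sym[OF G] S, of a]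
    by auto
  then show False using ind by blast
qed

text \<open>The kernel of A + I is spanned by (1, -2, -2, 1), the relation met in the case of
  diameter three; it supplies the coefficients -1, 2, 2 for the column of \<open>v3\<close>.\<close>

lemma ecc_spectrum_path4:
  assumes G: "connected_graph G" and iso: "graph_iso G (path_graph 4)"
  shows "count (ecc_spectrum G) (-1) = 1" "count (ecc_spectrum G) (-2) = 0" "card (pverts G) = 4"
proof -
  interpret pair_graph G using G by (simp add: connected_graph_def)
  interpret H: hop_metric "pverts G" "hop G" by (rule hop_metric_hop[OF G])
  note fin = connected_graph_finite[OF G]
  obtain v0 v1 v2 v3 where d: "distinct [v0, v1, v2, v3]" and V: "pverts G = {v0, v1, v2, v3}"
    and E: "parcs G = {(v0, v1), (v1, v0), (v1, v2), (v2, v1), (v2, v3), (v3, v2)}"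
    using iso graph_iso_path4_iff[OF pair_wf_digraph] by blast
  have one: "hop G x y = 1 \<longleftrightarrow> (x, y) \<in> {(v0, v1), (v1, v0), (v1, v2), (v2, v1), (v2, v3), (v3, v2)}"
    if "x \<in> pverts G" "y \<in> pverts G" for x y using hop_eq_1_iff[OF G that] unfolding E .
  have mem: "v0 \<in> pverts G" "v1 \<in> pverts G" "v2 \<in> pverts G" "v3 \<in> pverts G" unfolding V by auto
  have e: "ecc_entry G v0 v1 = 0" "ecc_entry G v0 v2 = 2" "ecc_entry G v0 v3 = 3"
    "ecc_entry G v1 v2 = 0" "ecc_entry G v1 v3 = 2" "ecc_entry G v2 v3 = 0"
    using H.path4_entry[OF V d one] mem by (simp_all add: ecc_entry_eq_entry[OF G])
  have e_self: "ecc_entry G x x = 0" if "x \<in> pverts G" for x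
    using that by (simp add: ecc_entry_eq_entry[OF G] H.entry_def)
  note e_sym = e[unfolded connected_graph_entry_sym[OF G mem(1,2)] connected_graph_entry_sym[OF G mem(1,3)]
    connected_graph_entry_sym[OF G mem(1,4)] connected_graph_entry_sym[OF G mem(2,3)]
    connected_graph_entry_sym[OF G mem(2,4)] connected_graph_entry_sym[OF G mem(3,4)]]
  note tab = e e_sym e_self[OF mem(1)] e_self[OF mem(2)] e_self[OF mem(3)] e_self[OF mem(4)]
  have ne: "v0 \<noteq> v1" "v0 \<noteq> v2" "v0 \<noteq> v3" "v1 \<noteq> v2" "v1 \<noteq> v3" "v2 \<noteq> v3"
    "v1 \<noteq> v0" "v2 \<noteq> v0" "v3 \<noteq> v0" "v2 \<noteq> v1" "v3 \<noteq> v1" "v3 \<noteq> v2" using d by auto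
  show card: "card (pverts G) = 4" using d by (simp add: V)
  \<comment> \<open>The principal minor on \<open>v0\<close>, \<open>v2\<close>, \<open>v3\<close>
    is -12.\<close>
  have "count (ecc_spectrum G) (complex_of_real (-1)) + card {v0, v2, v3} \<le> card (pverts G)"
  proof (rule ecc_spectrum_count_le[OF G])
    fix c :: "'a \<Rightarrow> real"
    assume rel: "\<And>u. u \<in> pverts G \<Longrightarrow>
      (\<Sum>v\<in>{v0, v2, v3}. c v * (ecc_entry G u v - (if u = v then -1 else 0))) = 0"
    have "c v0 + c v2 * 2 + c v3 * 3 = 0" "c v0 * 2 + c v2 = 0" "c v0 * 3 + c v3 = 0"
      using rel[OF mem(1)] rel[OF mem(3)] rel[OF mem(4)] by (simp_all add: ne tab)
    then show "\<forall>v\<in>{v0, v2, v3}. c v = 0" by simp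
  qed (use mem in auto)
  moreover have "card (pverts G) \<le> count (ecc_spectrum G) (complex_of_real (-1)) + card {v0, v1, v2}"
    \<comment> \<open>The column of \<open>v3\<close> is a combination of the other three.\<close>
  proof (rule ecc_spectrum_count_ge[OF fin, where U = "\<lambda>x l. ecc_entry G x l - (if x = l then -1 else 0)"
        and W = "\<lambda>l y. if y = v3 then (if l = v0 then -1 else 2) else if y = l then 1 else 0"])
    fix x y assume "x \<in> pverts G" "y \<in> pverts G"
    then have "x = v0 \<or> x = v1 \<or> x = v2 \<or> x = v3" "y = v0 \<or> y = v1 \<or> y = v2 \<or> y = v3" unfolding V by auto
    then show "ecc_entry G x y - (if x = y then -1 else 0) =
      (\<Sum>l\<in>{v0, v1, v2}. (ecc_entry G x l - (if x = l then -1 else 0)) *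
        (if y = v3 then (if l = v0 then -1 else 2) else if y = l then 1 else 0))"
      by (elim disjE) (simp_all add: ne tab)
  qed simp
  moreover have "card {v0, v2, v3} = 3" "card {v0, v1, v2} = 3" by (simp_all add: ne)
  moreover have of_real: "complex_of_real (-1) = -1" by simp
  ultimately show "count (ecc_spectrum G) (-1) = 1" unfolding card of_real by linarith
  \<comment> \<open>A + 2I is nonsingular: subtracting the row of \<open>v2\<close> from that of
    \<open>v0\<close> gives \<open>c v3 = 0\<close>, and the rows of \<open>v1\<close>,
    \<open>v3\<close>, \<open>v2\<close> then remove the remaining coefficients in turn.\<close>
  have "count (ecc_spectrum G) (complex_of_real (-2)) + card {v0, v1, v2, v3} \<le> card (pverts G)"
  proof (rule ecc_spectrum_count_le[OF G])
    fix c :: "'a \<Rightarrow> real"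
    assume rel: "\<And>u. u \<in> pverts G \<Longrightarrow>
      (\<Sum>v\<in>{v0, v1, v2, v3}. c v * (ecc_entry G u v - (if u = v then -2 else 0))) = 0"
    have "c v0 * 2 + c v2 * 2 + c v3 * 3 = 0" "c v1 * 2 + c v3 * 2 = 0"
      "c v0 * 2 + c v2 * 2 = 0" "c v0 * 3 + c v1 * 2 + c v3 * 2 = 0"
      using rel[OF mem(1)] rel[OF mem(2)] rel[OF mem(3)] rel[OF mem(4)] by (simp_all add: ne tab)
    then show "\<forall>v\<in>{v0, v1, v2, v3}. c v = 0" by simp
  qed (use mem in auto)
  then show "count (ecc_spectrum G) (-2) = 0" using card ne by simp
qed

text \<open>The eigenvalue -2 belongs to the difference of the unit vectors of \<open>u\<close> and
  \<open>v\<close>; it is recorded because the path on four vertices lacks it.\<close>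

lemma ecc_spectrum_complete_join_isolated2:
  assumes G: "connected_graph G" and n: "card (pverts G) = n" "n \<ge> 3"
    and iso: "graph_iso G (complete_graph (n - 2) \<or>\<^sub>G isolated_graph 2)"
  shows "count (ecc_spectrum G) (-1) = n - 3" "count (ecc_spectrum G) (-2) \<noteq> 0"
proof -
  interpret pair_graph G using G by (simp add: connected_graph_def)
  interpret H: hop_metric "pverts G" "hop G" by (rule hop_metric_hop[OF G])
  note fin = connected_graph_finite[OF G]
  obtain u v where uv: "u \<in> pverts G" "v \<in> pverts G" "u \<noteq> v"
    and adj: "\<forall>x\<in>pverts G. \<forall>y\<in>pverts G. (x, y) \<in> parcs G \<longleftrightarrow> x \<noteq> y \<and> {x, y} \<noteq> {u, v}"
    using iso graph_iso_complete_join_isolated2_iff[OF pair_wf_digraph fin n(1)] n by auto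
  have one: "hop G x y = 1 \<longleftrightarrow> x \<noteq> y \<and> {x, y} \<noteq> {u, v}" if "x \<in> pverts G" "y \<in> pverts G" for x y
    using hop_eq_1_iff[OF G that] adj that by simp
  have e: "ecc_entry G x y = (if x = y then 0 else if {x, y} = {u, v} then 2 else 1)"
    if "x \<in> pverts G" "y \<in> pverts G" for x y
    using H.one_non_edge_entry[OF _ uv one that] n ecc_entry_eq_entry[OF G that] by simp
  obtain s where s: "s \<in> pverts G" "s \<noteq> u" "s \<noteq> v"
  proof -
    have "card {u, v} < card (pverts G)" using n uv by simp
    then have "\<not> pverts G \<subseteq> {u, v}" using card_mono[of "{u, v}" "pverts G"] by auto
    then show ?thesis using that by auto
  qed
  \<comment> \<open>A + I is the all-ones matrix (\<open>l = 0\<close>) plus one extra unit at each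
    of the positions (u, v) and (v, u) (\<open>l = 1\<close> and \<open>l = 2\<close>).\<close>
  have "card (pverts G) \<le> count (ecc_spectrum G) (complex_of_real (-1)) + card {0, 1, 2 :: nat}"
  proof (rule ecc_spectrum_count_ge[OF fin,
        where U = "\<lambda>x l. if l = 0 \<or> l = 1 \<and> x = u \<or> l = 2 \<and> x = v then 1 else 0"
        and W = "\<lambda>l y. if l = 0 \<or> l = 1 \<and> y = v \<or> l = 2 \<and> y = u then 1 else 0"])
    fix x y assume "x \<in> pverts G" "y \<in> pverts G"
    then show "ecc_entry G x y - (if x = y then -1 else 0) = (\<Sum>l\<in>{0, 1, 2 :: nat}.
      (if l = 0 \<or> l = 1 \<and> x = u \<or> l = 2 \<and> x = v then 1 else 0) *
      (if l = 0 \<or> l = 1 \<and> y = v \<or> l = 2 \<and> y = u then 1 else 0))"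
      using uv(3) by (auto simp: e doubleton_eq_iff)
  qed simp
  moreover have "count (ecc_spectrum G) (complex_of_real (-1)) + card {u, v, s} \<le> card (pverts G)"
  proof (rule ecc_spectrum_count_le[OF G])
    fix c :: "'a \<Rightarrow> real"
    assume rel: "\<And>x. x \<in> pverts G \<Longrightarrow>
      (\<Sum>y\<in>{u, v, s}. c y * (ecc_entry G x y - (if x = y then -1 else 0))) = 0"
    have "c u + c v * 2 + c s = 0" "c u * 2 + c v + c s = 0" "c u + c v + c s = 0"
      using rel[OF uv(1)] rel[OF uv(2)] rel[OF s(1)] uv s uv(3)[symmetric] s(2,3)[symmetric]
      by (simp_all add: e doubleton_eq_iff)
    then show "\<forall>y\<in>{u, v, s}. c y = 0" by simp
  qed (use uv s in auto)
  ultimately show "count (ecc_spectrum G) (-1) = n - 3"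
    using n uv s by (simp add: card_insert_if split: if_splits)
  have "card (pverts G) \<le> count (ecc_spectrum G) (complex_of_real (-2)) + card (pverts G - {v})"
    \<comment> \<open>For the eigenvalue -2 the rows of \<open>u\<close> and \<open>v\<close> coincide.\<close>
  proof (rule ecc_spectrum_count_ge[OF fin,
        where U = "\<lambda>x l. if l = (if x = v then u else x) then 1 else 0"
        and W = "\<lambda>l y. ecc_entry G l y - (if l = y then -2 else 0)"])
    fix x y assume xy: "x \<in> pverts G" "y \<in> pverts G"
    let ?r = "if x = v then u else x"
    have "(\<Sum>l\<in>pverts G - {v}. (if l = ?r then 1 else 0) * (ecc_entry G l y - (if l = y then -2 else 0)))
      = (\<Sum>l\<in>pverts G - {v}. if l = ?r then ecc_entry G ?r y - (if ?r = y then -2 else 0) else 0)"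
      by (intro sum.cong refl) simp
    also have "\<dots> = ecc_entry G ?r y - (if ?r = y then -2 else 0)"
      using fin xy uv by (subst sum.delta) auto
    also have "\<dots> = ecc_entry G x y - (if x = y then -2 else 0)"
      using xy uv by (auto simp: e doubleton_eq_iff)
    finally show "ecc_entry G x y - (if x = y then -2 else 0) = (\<Sum>l\<in>pverts G - {v}.
      (if l = ?r then 1 else 0) * (ecc_entry G l y - (if l = y then -2 else 0)))" by simp
  qed (use fin in simp)
  moreover have "card (pverts G - {v}) < card (pverts G)" using fin uv(2) by (rule card_Diff1_less)
  moreover have of_real: "complex_of_real (-2) = -2" by simp
  ultimately show "count (ecc_spectrum G) (-2) \<noteq> 0" unfolding of_real by linarith
qed

section \<open>Classification and spectral determination\<close>

lemma count_neg1_imp_iso: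
  assumes G: "connected_graph G" and n: "card (pverts G) = n" "n \<ge> 4"
    and m: "count (ecc_spectrum G) (-1) = n - 3"
  shows "graph_iso G (path_graph 4) \<or> graph_iso G (complete_graph (n - 2) \<or>\<^sub>G isolated_graph 2)"
proof -
  interpret pair_graph G using G by (simp add: connected_graph_def)
  interpret H: hop_metric "pverts G" "hop G" by (rule hop_metric_hop[OF G])
  note fin = connected_graph_finite[OF G]
  have dep: H.four_columns_dependent
    unfolding H.four_columns_dependent_def
  proof (intro allI impI)
    fix S assume S: "S \<subseteq> pverts G" "card S = 4"
    \<comment> \<open>As n \<ge> 4, the truncated difference is exact and (n - 3) + 4 exceeds n by
      one.\<close>
    have "card (pverts G) < count (ecc_spectrum G) (complex_of_real (-1)) + card S"
      using m n S by simp
    from ecc_spectrum_dependent_columns[OF fin connected_graph_entry_sym[OF G] S(1) this]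
    obtain c :: "'a \<Rightarrow> real" where c: "\<exists>v\<in>S. c v \<noteq> 0"
      "\<forall>u\<in>pverts G. (\<Sum>v\<in>S. c v * (ecc_entry G u v - (if u = v then -1 else 0))) = 0" by blast
    have "(\<Sum>v\<in>S. c v * H.shifted u v) = 0" if "u \<in> pverts G" for u
    proof -
      have "(\<Sum>v\<in>S. c v * H.shifted u v) = (\<Sum>v\<in>S. c v * (ecc_entry G u v - (if u = v then -1 else 0)))"
        using S(1) that by (intro sum.cong refl) (auto simp: H.shifted_def ecc_entry_eq_entry[OF G])
      then show ?thesis using c(2) that by simp
    qed
    then show "\<exists>c :: 'a \<Rightarrow> real. (\<exists>v\<in>S. c v \<noteq> 0) \<and> (\<forall>u\<in>pverts G. (\<Sum>v\<in>S. c v * H.shifted u v) = 0)"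
      using c(1) by blast
  qed
  define hs where "hs = (\<lambda>(x, y). hop G x y) ` (pverts G \<times> pverts G)"
  have hs: "finite hs" "hs \<noteq> {}" using fin n by (auto simp: hs_def)
  \<comment> \<open>The diameter, attained at \<open>p\<close> and \<open>q\<close> below.\<close>
  define D where "D = Max hs"
  have max: "hop G x y \<le> D" if "x \<in> pverts G" "y \<in> pverts G" for x y
    unfolding D_def using hs(1) that by (intro Max_ge) (auto simp: hs_def)
  obtain p q where pq: "p \<in> pverts G" "q \<in> pverts G" "hop G p q = D"
    using Max_in[OF hs] by (auto simp: D_def hs_def)
  have "D \<noteq> 0 \<and> D \<noteq> 1"
  proof (rule ccontr)
    assume D: "\<not> ?thesis"
    have one: "hop G x y = (if x = y then 0 else 1)" if "x \<in> pverts G" "y \<in> pverts G" for x y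
      using max[OF that] H.hop_eq_0_iff[OF that] D by auto
    \<comment> \<open>A complete graph has multiplicity at least \<open>n - 1\<close>, since its shifted matrix has rank one.\<close>
    have "card (pverts G) \<le> count (ecc_spectrum G) (complex_of_real (-1)) + card {()}"
    proof (rule ecc_spectrum_count_ge[OF fin, where U = "\<lambda>_ _. 1" and W = "\<lambda>_ _. 1"])
      fix x y assume xy: "x \<in> pverts G" "y \<in> pverts G"
      have ecc: "H.ecc x = 1" if x: "x \<in> pverts G" for x
      proof -
        have "card {x} < card (pverts G)" using n by simp
        then have "\<not> pverts G \<subseteq> {x}" using card_mono[of "{x}" "pverts G"] by auto
        then obtain z where z: "z \<in> pverts G" "z \<noteq> x" by auto
        obtain y where "y \<in> pverts G" "hop G x y = H.ecc x" using H.ex_hop_eq_ecc[OF x] by blast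
        then show ?thesis using H.hop_le_ecc[OF z(1), of x] one x z by (auto split: if_splits)
      qed
      show "ecc_entry G x y - (if x = y then -1 else 0) = (\<Sum>l\<in>{()}. 1 * 1)"
        using xy by (simp add: ecc_entry_eq_entry[OF G] H.entry_def ecc one)
    qed simp
    then show False using m n by simp
  qed
  then consider "D \<ge> 3" | "D = 2" by linarith
  then show ?thesis
  proof cases
    case 1
    obtain v1 v2 where V: "pverts G = {p, v1, v2, q}" and d: "distinct [p, v1, v2, q]"
      and h: "hop G p v1 = 1" "hop G v1 v2 = 1" "hop G v2 q = 1" "hop G p v2 = 2" "hop G v1 q = 2" "hop G p q = 3"
      using H.diameter_ge_3_imp_path[OF dep pq(1,2,3) 1 max] by blast
    have mem: "p \<in> pverts G" "v1 \<in> pverts G" "v2 \<in> pverts G" "q \<in> pverts G" unfolding V by auto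
    have sy: "hop G v1 p = 1" "hop G v2 v1 = 1" "hop G q v2 = 1" "hop G v2 p = 2" "hop G q v1 = 2" "hop G q p = 3"
      using h H.hop_sym mem by auto
    have arc: "(x, y) \<in> parcs G \<longleftrightarrow> hop G x y = 1" if "x \<in> {p, v1, v2, q}" "y \<in> {p, v1, v2, q}" for x y
      using hop_eq_1_iff[OF G, of x y] that unfolding V by blast
    have "parcs G \<subseteq> pverts G \<times> pverts G" by (auto dest: wellformed')
    then have sub: "parcs G \<subseteq> {p, v1, v2, q} \<times> {p, v1, v2, q}" unfolding V .
    have E: "parcs G = {(p, v1), (v1, p), (v1, v2), (v2, v1), (v2, q), (q, v2)}"
    proof
      show "{(p, v1), (v1, p), (v1, v2), (v2, v1), (v2, q), (q, v2)} \<subseteq> parcs G"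
        using arc h sy by simp
      show "parcs G \<subseteq> {(p, v1), (v1, p), (v1, v2), (v2, v1), (v2, q), (q, v2)}"
      proof
        fix e assume e: "e \<in> parcs G"
        obtain x y where xy: "e = (x, y)" by fastforce
        then have "hop G x y = 1" and "x = p \<or> x = v1 \<or> x = v2 \<or> x = q" "y = p \<or> y = v1 \<or> y = v2 \<or> y = q"
          using e sub arc by auto
        then show "e \<in> {(p, v1), (v1, p), (v1, v2), (v2, v1), (v2, q), (q, v2)}"
          using h sy H.hop_self mem unfolding xy by (elim disjE) simp_all
      qed
    qed
    show ?thesis using graph_iso_path4_iff[OF pair_wf_digraph] V d E by blast
  next
    case 2
    have pq2: "hop G p q = 2" using pq 2 by simp
    have "p \<noteq> q" using pq2 pq by auto
    moreover have "(x, y) \<in> parcs G \<longleftrightarrow> x \<noteq> y \<and> {x, y} \<noteq> {p, q}" if xy: "x \<in> pverts G" "y \<in> pverts G" for x y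
    proof -
      have "hop G x y = 1" if "x \<noteq> y" "{x, y} \<noteq> {p, q}"
        using H.diameter_2_imp_one_non_edge[OF dep _ pq(1,2) pq2 _ xy that] max n 2 by simp
      moreover have "hop G q p = 2" using pq2 H.hop_sym pq by simp
      ultimately show ?thesis
        using hop_eq_1_iff[OF G xy, symmetric] pq2 xy by (auto simp: doubleton_eq_iff)
    qed
    ultimately show ?thesis
      using graph_iso_complete_join_isolated2_iff[OF pair_wf_digraph fin n(1)] n(2) pq(1,2) by auto
  qed
qed

theorem theorem3p3:
  fixes G :: "'a pair_pre_digraph" and n :: nat
  assumes "connected_graph G"
    and "card (pverts G) = n"
    and "n \<ge> 4"
  shows "(count (ecc_spectrum G) (-1) = n - 3 \<longleftrightarrow>
            graph_iso G (path_graph 4) \<or>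
            graph_iso G (complete_graph (n - 2) \<or>\<^sub>G isolated_graph 2))
       \<and> (graph_iso G (path_graph 4) \<or>
            graph_iso G (complete_graph (n - 2) \<or>\<^sub>G isolated_graph 2) \<longrightarrow>
            determined_by_ecc_spectrum TYPE('b) G)"
proof -
  let ?iso = "graph_iso G (path_graph 4) \<or> graph_iso G (complete_graph (n - 2) \<or>\<^sub>G isolated_graph 2)"
  have n3: "n \<ge> 3" using assms(3) by simp
  have m: "count (ecc_spectrum G) (-1) = n - 3" if ?iso
    using that ecc_spectrum_path4[OF assms(1)] ecc_spectrum_complete_join_isolated2[OF assms(1,2) n3] assms(2)
    by auto
  have "determined_by_ecc_spectrum TYPE('b) G" if iso: ?iso
    unfolding determined_by_ecc_spectrum_def
  proof (intro allI impI, elim conjE)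
    fix H :: "'b pair_pre_digraph"
    assume H: "connected_graph H" "ecc_spectrum H = ecc_spectrum G"
    \<comment> \<open>The spectrum contains one eigenvalue per vertex, so cospectral graphs have
      equal order and the classification applies to \<open>H\<close> with the same
      \<open>n\<close>.\<close>
    have card: "card (pverts H) = n"
      using H assms(1,2) size_ecc_spectrum connected_graph_finite by metis
    have "graph_iso H (path_graph 4) \<or> graph_iso H (complete_graph (n - 2) \<or>\<^sub>G isolated_graph 2)"
      using count_neg1_imp_iso[OF H(1) card assms(3)] H(2) m[OF iso] by simp
    \<comment> \<open>The eigenvalue -2 tells the two graphs apart.\<close>
    then show "graph_iso H G"
      using iso H(2) ecc_spectrum_path4(2)[OF H(1)] ecc_spectrum_path4(2)[OF assms(1)]
        ecc_spectrum_complete_join_isolated2(2)[OF H(1) card n3]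
        ecc_spectrum_complete_join_isolated2(2)[OF assms(1,2) n3]
        graph_iso_if_common_iso[of G _ H] by metis
  qed
  then show ?thesis using m count_neg1_imp_iso[OF assms] by blast
qed

end
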